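(* For a positive proportion of primes $p$, there exist nonnegative integers $\alpha$ and $\beta$ (depending on $p$) such that $$\sum_{n=0}^{\infty} b_{25}(2pn+\alpha)\,q^n\equiv q^{\beta}\sum_{n=0}^{\infty} b_{25}(2n+1)\,q^{pn}\pmod 2.$$
   Context: For a positive integer $t$, $b_t(n)$ denotes the number of $t$-regular partitions of $n$, i.e. partitions of $n$ none of whose parts is divisible by $t$ (with $b_t(0)=1$); equivalently $\sum_{n\ge0}b_t(n)q^n=\prod_{j\ge1}\frac{1-q^{tj}}{1-q^j}$. A congruence between formal power series modulo $2$ means coefficientwise congruence. "A positive proportion of primes" means a set of primes having positive (lower) density within the set of all primes. *)

theory Defs
  imports
    "HOL-Computational_Algebra.Computational_Algebra"
    "HOL-Number_Theory.Cong"
    "HOL-Library.Multiset"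
    "HOL-Library.Extended_Real"
    "HOL-Library.Liminf_Limsup"
begin

definition partitions :: "nat \<Rightarrow> nat multiset set" where
  "partitions n = {M. (\<forall>k \<in># M. 0 < k) \<and> \<Sum>\<^sub># M = n}"

definition regular_partitions :: "nat \<Rightarrow> nat \<Rightarrow> nat multiset set" where
  "regular_partitions t n = {M \<in> partitions n. \<forall>k \<in># M. \<not> t dvd k}"

definition num_regular_partitions :: "nat \<Rightarrow> nat \<Rightarrow> nat" where
  "num_regular_partitions t n = card (regular_partitions t n)"

lemma finite_partitions: "finite (partitions n)"
proof -
  have "partitions n \<subseteq> (\<lambda>xs. mset xs) ` {xs. set xs \<subseteq> {..n} \<and> length xs \<le> n}"
  proof
    fix M assume M: "M \<in> partitions n"
    obtain xs where xs: "mset xs = M" using ex_mset by blast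
    have "(\<forall>k\<in>set ys. 0 < k) \<Longrightarrow> length ys \<le> sum_list ys" for ys :: "nat list"
      by (induction ys) auto
    then have "length xs \<le> n"
      using M xs by (auto simp: partitions_def sum_mset_sum_list)
    moreover have "set xs \<subseteq> {..n}"
      using M xs by (auto simp: partitions_def sum_mset_sum_list member_le_sum_list)
    ultimately show "M \<in> (\<lambda>xs. mset xs) ` {xs. set xs \<subseteq> {..n} \<and> length xs \<le> n}"
      using xs by blast
  qed
  then show ?thesis
    by (rule finite_subset) (simp add: finite_lists_length_le)
qed

definition fps_cong :: "int fps \<Rightarrow> int fps \<Rightarrow> int \<Rightarrow> bool" where
  "fps_cong F G m \<longleftrightarrow> (\<forall>n. [fps_nth F n = fps_nth G n] (mod m))"

text \<open>Lower density relative to the set of all primes. The finitely many indices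
  \<open>x < 2\<close>, where the quotient is \<open>0 / 0\<close>, do not affect the limit inferior.\<close>

definition lower_prime_density :: "nat set \<Rightarrow> ereal" where
  "lower_prime_density S =
     liminf (\<lambda>x. ereal (real (card {p \<in> S. prime p \<and> p \<le> x}) /
                        real (card {p. prime p \<and> p \<le> x})))"

end

theory Submission
  imports Defs "HOL-Library.Z2" "HOL-Library.Disjoint_Sets" "HOL-Number_Theory.Number_Theory"
begin

text \<open>
  Every prime \<open>p \<equiv> \<plusminus>1 (mod 5)\<close> works, with \<open>\<alpha> = 2 p - 1\<close> and \<open>\<beta> = p - 1\<close>. Put \<open>c(n) = b\<^sub>2\<^sub>5(2 n - 1)\<close>;
  the congruence then says \<open>c(p k) \<equiv> c(k / p)\<close>, and it follows by pairing divisors from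
  \<open>\<Sum> c(n) q\<^sup>n \<equiv> \<Sum> q^(s\<^sup>2) + \<Sum> q^(d e)  (mod 2)\<close>, where \<open>s\<close> runs over the positive integers prime to 5 and
  \<open>(d, e)\<close> over the pairs with \<open>d \<equiv> \<plusminus>1\<close>, \<open>e \<equiv> \<plusminus>2 (mod 5)\<close>.

  To prove this identity over the field with two elements, let \<open>f = \<Prod> (1 + q\<^sup>k)\<close> and
  \<open>h = q f(q\<^sup>2\<^sup>5) / f = \<Sum> b\<^sub>2\<^sub>5(n) q^(n + 1)\<close>. Writing \<open>D = q d/dq\<close>, the even part of \<open>h\<close> is
  \<open>h + D h = (\<Sum> c(n) q\<^sup>n)\<^sup>2\<close>. By the pentagonal number theorem \<open>f\<close> only has
  exponents 0, 1, 2 modulo 5, the middle part being \<open>m = q f(q\<^sup>2\<^sup>5)\<close>; comparing residue classes in the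
  formula for \<open>D f / f\<close> expresses \<open>h\<close> and the theta series \<open>\<Sum> q^(s\<^sup>2)\<close> (\<open>s \<equiv> 1\<close>, \<open>s \<equiv> 2\<close>)
  rationally through one series \<open>\<rho>\<close> (the Rogers-Ramanujan continued fraction at \<open>q\<^sup>5\<close>), and a three-term
  relation for indefinite binary quadratic forms does the same for \<open>\<Sum> q^(d e)\<close>. The identity becomes
  one between polynomials in \<open>\<rho>\<close>.

  The primes \<open>p \<equiv> \<plusminus>1 (mod 5)\<close> have positive lower density by Mertens' argument for the
  quadratic character modulo 5 together with Chebyshev's upper bound.
\<close>

section \<open>Generating functions modulo 2\<close>

declare add_bit_eq_xor [simp del] mult_bit_eq_and [simp del]

lemma of_nat_bit: "(of_nat n :: bit) = of_bool (odd n)"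
  by (induction n) auto

text \<open>The pairs \<open>x\<close>, \<open>i x\<close> cancel in the sum of 1 over
  \<open>A\<close> in the field with two elements.\<close>

lemma even_card_involution:
  assumes "\<And>x. x \<in> A \<Longrightarrow> i x \<in> A" and "\<And>x. x \<in> A \<Longrightarrow> i (i x) = x"
    and "\<And>x. x \<in> A \<Longrightarrow> i x \<noteq> x"
  shows "even (card A)"
proof -
  have "(\<Sum>x\<in>A. 1 :: bit) = 0"
    by (rule sum_involution_eq_0[of A "\<lambda>_. 1" i]) (use assms in auto)
  then show ?thesis by (simp add: of_nat_bit split: if_splits)
qed

text \<open>Coefficients lie in the field with two elements, so an identity of such series is a
  congruence modulo 2. An infinite fibre would have \<open>card\<close> equal to 0;
  \<open>finite_fibres\<close> excludes this where series are added, multiplied or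
  cancelled.\<close>

definition gf :: "'a set \<Rightarrow> ('a \<Rightarrow> nat) \<Rightarrow> bit fps" where
  "gf A w = Abs_fps (\<lambda>n. of_nat (card {x \<in> A. w x = n}))"

definition finite_fibres :: "'a set \<Rightarrow> ('a \<Rightarrow> nat) \<Rightarrow> bool" where
  "finite_fibres A w \<longleftrightarrow> (\<forall>n. finite {x \<in> A. w x = n})"

lemma gf_nth: "gf A w $ n = of_nat (card {x \<in> A. w x = n})"
  by (simp add: gf_def)

lemma of_nat_bit_eq_iff: "of_nat m = (of_nat n :: bit) \<longleftrightarrow> even m = even n"
  by (simp add: of_nat_bit)

lemma gf_reindex:
  assumes "bij_betw f A B" and "\<And>x. x \<in> A \<Longrightarrow> w (f x) = v x"
  shows "gf B w = gf A v"
proof (rule fps_ext)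
  fix n
  have "bij_betw f {x \<in> A. v x = n} {y \<in> B. w y = n}"
    using assms unfolding bij_betw_def inj_on_def by auto
  then show "gf B w $ n = gf A v $ n" by (simp add: gf_nth bij_betw_same_card)
qed

lemma gf_cong: "A = B \<Longrightarrow> (\<And>x. x \<in> B \<Longrightarrow> w x = v x) \<Longrightarrow> gf A w = gf B v"
  by (rule gf_reindex[of id, symmetric, THEN sym]) auto

text \<open>Within each fibre the points moved by \<open>i\<close> pair up and vanish modulo
  2.\<close>

lemma gf_involution:
  assumes "finite_fibres A w"
    and "\<And>x. x \<in> A \<Longrightarrow> i x \<in> A" and "\<And>x. x \<in> A \<Longrightarrow> i (i x) = x"
    and "\<And>x. x \<in> A \<Longrightarrow> w (i x) = w x"
  shows "gf A w = gf {x \<in> A. i x = x} w"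
proof (rule fps_ext)
  fix n
  let ?A = "{x \<in> A. w x = n}" and ?F = "{x \<in> {x \<in> A. i x = x}. w x = n}"
  have fin: "finite ?A" using assms(1) by (simp add: finite_fibres_def)
  have "even (card (?A - ?F))"
    by (rule even_card_involution[of _ i]) (use fin assms in \<open>auto\<close>)
  moreover have "card (?A - ?F) = card ?A - card ?F" "card ?F \<le> card ?A"
    using fin by (auto intro!: card_Diff_subset card_mono intro: finite_subset[OF _ fin])
  ultimately show "gf A w $ n = gf {x \<in> A. i x = x} w $ n"
    by (auto simp: gf_nth of_nat_bit_eq_iff)
qed

lemma gf_Un:
  assumes "finite_fibres A w" "finite_fibres B w" "A \<inter> B = {}"
  shows "gf (A \<union> B) w = gf A w + gf B w"
proof (rule fps_ext)
  fix n
  have "{x \<in> A \<union> B. w x = n} = {x \<in> A. w x = n} \<union> {x \<in> B. w x = n}" by auto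
  then have "card {x \<in> A \<union> B. w x = n} = card {x \<in> A. w x = n} + card {x \<in> B. w x = n}"
    using assms by (simp add: finite_fibres_def card_Un_disjoint disjoint_iff)
  then show "gf (A \<union> B) w $ n = (gf A w + gf B w) $ n" by (simp add: gf_nth)
qed

lemma gf_mult:
  assumes "finite_fibres A w" "finite_fibres B v"
  shows "gf A w * gf B v = gf (A \<times> B) (\<lambda>(x, y). w x + v y)"
proof (rule fps_ext)
  fix n
  have eq: "{z \<in> A \<times> B. (\<lambda>(x, y). w x + v y) z = n} =
      (\<Union>i\<in>{0..n}. {x \<in> A. w x = i} \<times> {y \<in> B. v y = n - i})" by auto
  have "card {z \<in> A \<times> B. (\<lambda>(x, y). w x + v y) z = n} =
      (\<Sum>i=0..n. card ({x \<in> A. w x = i} \<times> {y \<in> B. v y = n - i}))"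
    unfolding eq using assms by (intro card_UN_disjoint) (auto simp: finite_fibres_def)
  then show "(gf A w * gf B v) $ n = gf (A \<times> B) (\<lambda>(x, y). w x + v y) $ n"
    by (simp add: fps_mult_nth gf_nth card_cartesian_product)
qed

lemma finite_fibres_Times:
  assumes "finite_fibres A w" "finite_fibres B v"
  shows "finite_fibres (A \<times> B) (\<lambda>(x, y). w x + v y)"
  unfolding finite_fibres_def
proof
  fix n
  have eq: "{z \<in> A \<times> B. (\<lambda>(x, y). w x + v y) z = n} =
      (\<Union>i\<in>{0..n}. {x \<in> A. w x = i} \<times> {y \<in> B. v y = n - i})" by auto
  show "finite {z \<in> A \<times> B. (\<lambda>(x, y). w x + v y) z = n}"
    unfolding eq using assms by (auto simp: finite_fibres_def)
qed

lemma finite_fibres_subset: "finite_fibres B w \<Longrightarrow> A \<subseteq> B \<Longrightarrow> finite_fibres A w"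
  unfolding finite_fibres_def by (auto intro: finite_subset[where B = "{x \<in> B. w x = n}" for n])

lemma swap_eq_self_iff: "prod.swap z = z \<longleftrightarrow> fst z = snd z"
  unfolding prod_eq_iff fst_swap snd_swap by (metis (full_types))

text \<open>Frobenius: swapping coordinates cancels all off-diagonal pairs.\<close>

lemma gf_square:
  assumes "finite_fibres A w"
  shows "(gf A w)\<^sup>2 = gf A (\<lambda>x. 2 * w x)"
proof -
  let ?v = "\<lambda>(x, y). w x + w y"
  have "(gf A w)\<^sup>2 = gf (A \<times> A) ?v" using gf_mult[OF assms assms] by (simp add: power2_eq_square)
  also have "\<dots> = gf {z \<in> A \<times> A. prod.swap z = z} ?v"
    by (rule gf_involution[where i = prod.swap, OF finite_fibres_Times[OF assms assms]]) auto
  also have "\<dots> = gf A (\<lambda>x. 2 * w x)"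
  proof (rule gf_reindex)
    show "bij_betw (\<lambda>x. (x, x)) A {z \<in> A \<times> A. prod.swap z = z}"
      by (rule bij_betw_byWitness[where f' = fst]) (auto simp: swap_eq_self_iff)
  qed simp
  finally show ?thesis .
qed

text \<open>Lets facts about \<open>gf\<close>, Frobenius in particular, be applied to an arbitrary
  series.\<close>

lemma gf_support: "f = gf {n. f $ n \<noteq> 0} (\<lambda>n. n)"
proof (rule fps_ext)
  fix n
  have "{x \<in> {n. f $ n \<noteq> 0}. x = n} = (if f $ n \<noteq> 0 then {n} else {})" by auto
  then show "f $ n = gf {n. f $ n \<noteq> 0} (\<lambda>n. n) $ n"
    by (auto simp: gf_nth)
qed

lemma bit_fps_square_nth: "(f\<^sup>2 :: bit fps) $ n = (if even n then f $ (n div 2) else 0)"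
proof -
  have "f\<^sup>2 = gf {n. f $ n \<noteq> 0} (\<lambda>n. 2 * n)"
    by (subst gf_support[of f], rule gf_square) (auto simp: finite_fibres_def)
  moreover have "{x \<in> {n. f $ n \<noteq> 0}. 2 * x = n} = (if even n \<and> f $ (n div 2) \<noteq> 0 then {n div 2} else {})"
    by auto
  ultimately show ?thesis by (auto simp: gf_nth)
qed

lemma bit_fps_two: "(2 :: bit fps) = 0"
  by (rule fps_ext) (simp add: fps_numeral_nth)

lemma bit_fps_double: "(f :: bit fps) + f = 0"
  using bit_fps_two by (metis mult_2 mult_zero_left)

lemma bit_fps_uminus: "- (f :: bit fps) = f"
  using bit_fps_double by (metis add.inverse_unique)

lemma bit_fps_minus: "(f :: bit fps) - g = f + g"
  by (metis bit_fps_uminus diff_conv_add_uminus)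

section \<open>Theta and Lambert series modulo 5\<close>

text \<open>Common elements are counted twice. In the three-term relation below, "exactly one of two
  sign conditions holds" is such a symmetric difference.\<close>

lemma gf_symdiff:
  assumes "finite_fibres A w" "finite_fibres B w"
  shows "gf ((A - B) \<union> (B - A)) w = gf A w + gf B w"
proof -
  have fin: "finite_fibres C w" if "C \<subseteq> A \<or> C \<subseteq> B" for C
    using that assms finite_fibres_subset by blast
  have "gf ((A - B) \<union> (A \<inter> B)) w = gf (A - B) w + gf (A \<inter> B) w"
    "gf ((B - A) \<union> (A \<inter> B)) w = gf (B - A) w + gf (A \<inter> B) w"
    by (rule gf_Un; auto intro!: fin)+
  moreover have "(A - B) \<union> (A \<inter> B) = A" "(B - A) \<union> (A \<inter> B) = B" by auto
  moreover have "gf ((A - B) \<union> (B - A)) w = gf (A - B) w + gf (B - A) w"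
    by (rule gf_Un) (auto intro!: fin)
  ultimately show ?thesis
    using bit_fps_double[of "gf (A \<inter> B) w"] by (simp add: algebra_simps)
qed

text \<open>Here \<open>s\<close> takes both signs; for \<open>c\<close> prime to 5 the class of
  \<open>c\<close> contains at most one of \<open>s\<close> and \<open>- s\<close>.\<close>

definition theta :: "int \<Rightarrow> bit fps" where
  "theta c = gf {s. [s = c] (mod 5)} (\<lambda>s. nat (s\<^sup>2))"

text \<open>Both factors may be negative together, so the class of \<open>a\<close> accounts for
  positive divisors in the classes of \<open>a\<close> and \<open>- a\<close>. Working over the
  integers permits linear changes of variables.\<close>

definition lambert :: "int \<Rightarrow> int \<Rightarrow> bit fps" where
  "lambert a b = gf {(d, e). [d = a] (mod 5) \<and> [e = b] (mod 5) \<and> 0 < d * e} (\<lambda>(d, e). nat (d * e))"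

lemma finite_fibres_square: "finite_fibres A (\<lambda>s :: int. nat (s\<^sup>2))"
  unfolding finite_fibres_def
proof
  fix n
  have "{s \<in> A. nat (s\<^sup>2) = n} \<subseteq> {- int n..int n}"
  proof
    fix s assume "s \<in> {s \<in> A. nat (s\<^sup>2) = n}"
    then have "s\<^sup>2 = int n" by auto
    moreover have "\<bar>s\<bar> \<le> s\<^sup>2"
    proof (cases "s = 0")
      case False
      then have "\<bar>s\<bar> * 1 \<le> \<bar>s\<bar> * \<bar>s\<bar>" by (intro mult_left_mono) linarith+
      then show ?thesis by (simp add: power2_eq_square)
    qed simp
    ultimately have "\<bar>s\<bar> \<le> int n" by simp
    then show "s \<in> {- int n..int n}" by auto
  qed
  then show "finite {s \<in> A. nat (s\<^sup>2) = n}" by (rule finite_subset) simp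
qed

lemma finite_fibres_mult: "finite_fibres {(d, e). P d e \<and> 0 < d * e} (\<lambda>(d :: int, e). nat (d * e))"
  unfolding finite_fibres_def
proof
  fix n
  have "{z \<in> {(d, e). P d e \<and> 0 < d * e}. (\<lambda>(d :: int, e). nat (d * e)) z = n} \<subseteq>
      {- int n..int n} \<times> {- int n..int n}"
  proof
    fix z assume z: "z \<in> {z \<in> {(d, e). P d e \<and> 0 < d * e}. (\<lambda>(d :: int, e). nat (d * e)) z = n}"
    obtain d e where [simp]: "z = (d, e)" by fastforce
    from z have n: "d * e = int n" and pos: "0 < d * e" by auto
    have "\<bar>d\<bar> * \<bar>e\<bar> = int n" using n by (simp add: abs_mult[symmetric])
    moreover have "d \<noteq> 0" "e \<noteq> 0" using pos by auto
    then have "\<bar>d\<bar> \<ge> 1" "\<bar>e\<bar> \<ge> 1" by linarith+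
    ultimately have "\<bar>d\<bar> \<le> int n" "\<bar>e\<bar> \<le> int n"
      by (metis abs_ge_zero mult.commute mult_cancel_left1 mult_left_mono)+
    then show "z \<in> {- int n..int n} \<times> {- int n..int n}" by auto
  qed
  then show "finite {z \<in> {(d, e). P d e \<and> 0 < d * e}. (\<lambda>(d :: int, e). nat (d * e)) z = n}"
    by (rule finite_subset) simp
qed

lemma finite_fibres_lambert:
  "finite_fibres {(d, e). [d = a] (mod 5) \<and> [e = b] (mod 5) \<and> 0 < d * e} (\<lambda>(d :: int, e). nat (d * e))"
  by (rule finite_fibres_subset[OF finite_fibres_mult[of "\<lambda>_ _. True"]]) auto

lemma theta_cong: "[a = b] (mod 5) \<Longrightarrow> theta a = theta b"
  unfolding theta_def cong_def by simp

lemma lambert_cong: "[a = a'] (mod 5) \<Longrightarrow> [b = b'] (mod 5) \<Longrightarrow> lambert a b = lambert a' b'"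
  unfolding lambert_def cong_def by simp

lemma cong_uminus_iff: "[- x = y] (mod m) \<longleftrightarrow> [x = - y] (mod m)" for x y m :: int
  using cong_minus_minus_iff[of "- x" y m] by simp

lemma theta_uminus: "theta (- c) = theta c"
  unfolding theta_def
  by (rule gf_reindex[of uminus])
    (auto intro!: bij_betw_byWitness[where f' = uminus] simp: cong_uminus_iff)

text \<open>The sign change cancels every nonzero \<open>s\<close>.\<close>

lemma theta_0: "theta 0 = 1"
proof -
  have "theta 0 = gf {s \<in> {s. [s = 0] (mod 5)}. - s = s} (\<lambda>s. nat (s\<^sup>2))"
    unfolding theta_def by (rule gf_involution[OF finite_fibres_square]) (auto simp: cong_uminus_iff)
  also have "{s :: int \<in> {s. [s = 0] (mod 5)}. - s = s} = {0}" by auto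
  also have "gf {0 :: int} (\<lambda>s. nat (s\<^sup>2)) = 1"
  proof (rule fps_ext)
    fix n
    have "{s \<in> {0 :: int}. nat (s\<^sup>2) = n} = (if n = 0 then {0} else {})" by auto
    then show "gf {0 :: int} (\<lambda>s. nat (s\<^sup>2)) $ n = 1 $ n" by (simp add: gf_nth)
  qed
  finally show ?thesis .
qed

lemma lambert_uminus: "lambert (- a) (- b) = lambert a b"
  unfolding lambert_def
  by (rule gf_reindex[of "\<lambda>(d, e). (- d, - e)"])
    (auto intro!: bij_betw_byWitness[where f' = "\<lambda>(d, e). (- d, - e)"] simp: cong_uminus_iff)

text \<open>Exchanging \<open>d\<close> and \<open>e\<close> leaves only the diagonal, whose entries
  are nonzero because their class is.\<close>

lemma lambert_diag:
  assumes "\<not> [a = 0] (mod 5)"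
  shows "lambert a a = theta a"
proof -
  let ?A = "{(d, e). [d = a] (mod 5) \<and> [e = a] (mod 5) \<and> 0 < d * e}"
  have "lambert a a = gf {z \<in> ?A. prod.swap z = z} (\<lambda>(d, e). nat (d * e))"
    unfolding lambert_def
    by (rule gf_involution[where i = prod.swap, OF finite_fibres_lambert]) (auto simp: mult.commute)
  also have "\<dots> = theta a"
    unfolding theta_def
  proof (rule gf_reindex)
    have "0 < s * s" if "[s = a] (mod 5)" for s
      using assms that by (auto simp: cong_sym_eq zero_less_mult_iff linorder_neq_iff[symmetric])
    then show "bij_betw (\<lambda>s. (s, s)) {s. [s = a] (mod 5)} {z \<in> ?A. prod.swap z = z}"
      by (intro bij_betw_byWitness[where f' = fst]) (auto simp: swap_eq_self_iff simp del: swap_simp)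
  qed (simp add: power2_eq_square)
  finally show ?thesis .
qed

text \<open>The product counts triples by \<open>s^2 + d e\<close>. Leaving \<open>f\<close> and
  \<open>X\<close> free allows three such products, after different substitutions, to be compared
  inside one set of triples.\<close>

lemma lambert_mult_theta:
  assumes "bij_betw f ({(d, e). [d = a] (mod 5) \<and> [e = b] (mod 5) \<and> 0 < d * e} \<times> {s. [s = c] (mod 5)}) X"
    and "\<And>d e s. 0 < d * e \<Longrightarrow> w (f ((d, e), s)) = nat (d * e + s\<^sup>2)"
  shows "gf X w = lambert a b * theta c" "finite_fibres X w"
proof -
  let ?P = "{(d, e). [d = a] (mod 5) \<and> [e = b] (mod 5) \<and> 0 < d * e} \<times> {s. [s = c] (mod 5)}"
  let ?v = "\<lambda>(p, s). (\<lambda>(d, e). nat (d * e)) p + nat (s\<^sup>2)"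
  have w: "w (f x) = ?v x" if "x \<in> ?P" for x
    using that assms(2) by (auto simp: nat_add_distrib)
  have "gf X w = gf ?P ?v" by (rule gf_reindex[OF assms(1)]) (rule w)
  then show "gf X w = lambert a b * theta c"
    unfolding lambert_def theta_def
    by (simp only: gf_mult[OF finite_fibres_lambert finite_fibres_square])
  have "finite_fibres ?P ?v"
    by (rule finite_fibres_Times[OF finite_fibres_lambert finite_fibres_square])
  moreover have "{y \<in> X. w y = n} = f ` {x \<in> ?P. ?v x = n}" for n
    using assms(1) w unfolding bij_betw_def by (auto simp del: mem_Times_iff)
  ultimately show "finite_fibres X w"
    by (simp add: finite_fibres_def)
qed

text \<open>
  The three products count the binary quadratic forms \<open>d x\<^sup>2 + 2 s x y - e y\<^sup>2\<close> in a fixed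
  residue class modulo 5 by \<open>s\<^sup>2 + d e\<close>, according to which two of the values at
  \<open>(1, 0)\<close>, \<open>(0, 1)\<close>, \<open>(1, 1)\<close> have opposite signs. None of these values is zero, so
  every form is counted either never or twice.
\<close>

lemma lambert_theta_three_term:
  assumes "\<not> [a = 0] (mod 5)" "\<not> [b = 0] (mod 5)" "\<not> [a + 2 * c - b = 0] (mod 5)"
  shows "lambert a b * theta c + lambert a (b - a - 2 * c) * theta (a + c) =
    lambert (a - b + 2 * c) b * theta (c - b)"
proof -
  define X where "X = {(d, s, e). [d = a] (mod 5) \<and> [s = c] (mod 5) \<and> [e = b] (mod 5)}"
  define W where "W = (\<lambda>(d :: int, s, e). nat (s\<^sup>2 + d * e))"
  define X1 where "X1 = X \<inter> {(d, s, e). 0 < d * e}"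
  define X2 where "X2 = X \<inter> {(d, s, e). 0 < d * (e - d - 2 * s)}"
  define X3 where "X3 = X \<inter> {(d, s, e). 0 < (d + 2 * s - e) * e}"
  have c1: "[s - d = c] (mod 5)" if "[d = a] (mod 5)" "[s = a + c] (mod 5)" for d s
    using cong_diff[OF that(2,1)] by simp
  have c2: "[2 * s - d + e = b] (mod 5)"
    if "[d = a] (mod 5)" "[e = b - a - 2 * c] (mod 5)" "[s = a + c] (mod 5)" for d s e
    using cong_add[OF cong_diff[OF cong_scalar_left[OF that(3), of 2] that(1)] that(2)] by (simp add: algebra_simps)
  have c3: "[e - d - 2 * s = b - a - 2 * c] (mod 5)"
    if "[d = a] (mod 5)" "[s = c] (mod 5)" "[e = b] (mod 5)" for d s e
    by (intro cong_diff cong_scalar_left that)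
  have c4: "[s + d = a + c] (mod 5)" if "[d = a] (mod 5)" "[s = c] (mod 5)" for d s
    using cong_add[OF that] by (simp add: add.commute)
  have c5: "[d - 2 * s - e = a] (mod 5)"
    if "[d = a - b + 2 * c] (mod 5)" "[e = b] (mod 5)" "[s = c - b] (mod 5)" for d s e
    using cong_diff[OF cong_diff[OF that(1) cong_scalar_left[OF that(3), of 2]] that(2)] by (simp add: algebra_simps)
  have c6: "[s + e = c] (mod 5)" if "[e = b] (mod 5)" "[s = c - b] (mod 5)" for s e
    using cong_add[OF that(2,1)] by simp
  have c7: "[d + 2 * s - e = a - b + 2 * c] (mod 5)"
    if "[d = a] (mod 5)" "[s = c] (mod 5)" "[e = b] (mod 5)" for d s e
    using cong_diff[OF cong_add[OF that(1) cong_scalar_left[OF that(2), of 2]] that(3)] by (simp add: algebra_simps)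
  have c8: "[s - e = c - b] (mod 5)" if "[s = c] (mod 5)" "[e = b] (mod 5)" for s e
    by (intro cong_diff that)
  have b1: "bij_betw (\<lambda>((d, e), s). (d, s, e)) ({(d, e). [d = a] (mod 5) \<and> [e = b] (mod 5) \<and> 0 < d * e} \<times>
      {s. [s = c] (mod 5)}) X1"
    unfolding X1_def X_def by (rule bij_betw_byWitness[where f' = "\<lambda>(d, s, e). ((d, e), s)"]) auto
  have b2: "bij_betw (\<lambda>((d, e), s). (d, s - d, 2 * s - d + e))
      ({(d, e). [d = a] (mod 5) \<and> [e = b - a - 2 * c] (mod 5) \<and> 0 < d * e} \<times>
      {s. [s = a + c] (mod 5)}) X2"
    unfolding X2_def X_def
  proof (rule bij_betw_byWitness[where f' = "\<lambda>(d, s, e). ((d, e - d - 2 * s), s + d)"])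
    show "(\<lambda>((d, e), s). (d, s - d, 2 * s - d + e)) `
        ({(d, e). [d = a] (mod 5) \<and> [e = b - a - 2 * c] (mod 5) \<and> 0 < d * e} \<times> {s. [s = a + c] (mod 5)})
        \<subseteq> {(d, s, e). [d = a] (mod 5) \<and> [s = c] (mod 5) \<and> [e = b] (mod 5)} \<inter>
          {(d, s, e). 0 < d * (e - d - 2 * s)}"
      by (auto intro: c1 c2)
    show "(\<lambda>(d, s, e). ((d, e - d - 2 * s), s + d)) `
        ({(d, s, e). [d = a] (mod 5) \<and> [s = c] (mod 5) \<and> [e = b] (mod 5)} \<inter>
          {(d, s, e). 0 < d * (e - d - 2 * s)})
        \<subseteq> {(d, e). [d = a] (mod 5) \<and> [e = b - a - 2 * c] (mod 5) \<and> 0 < d * e} \<times> {s. [s = a + c] (mod 5)}"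
      by (auto intro: c3 c4)
  qed auto
  have b3: "bij_betw (\<lambda>((d, e), s). (d - 2 * s - e, s + e, e))
      ({(d, e). [d = a - b + 2 * c] (mod 5) \<and> [e = b] (mod 5) \<and> 0 < d * e} \<times>
      {s. [s = c - b] (mod 5)}) X3"
    unfolding X3_def X_def
  proof (rule bij_betw_byWitness[where f' = "\<lambda>(d, s, e). ((d + 2 * s - e, e), s - e)"])
    show "(\<lambda>((d, e), s). (d - 2 * s - e, s + e, e)) `
        ({(d, e). [d = a - b + 2 * c] (mod 5) \<and> [e = b] (mod 5) \<and> 0 < d * e} \<times> {s. [s = c - b] (mod 5)})
        \<subseteq> {(d, s, e). [d = a] (mod 5) \<and> [s = c] (mod 5) \<and> [e = b] (mod 5)} \<inter>
          {(d, s, e). 0 < (d + 2 * s - e) * e}"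
      by (auto intro: c5 c6)
    show "(\<lambda>(d, s, e). ((d + 2 * s - e, e), s - e)) `
        ({(d, s, e). [d = a] (mod 5) \<and> [s = c] (mod 5) \<and> [e = b] (mod 5)} \<inter>
          {(d, s, e). 0 < (d + 2 * s - e) * e})
        \<subseteq> {(d, e). [d = a - b + 2 * c] (mod 5) \<and> [e = b] (mod 5) \<and> 0 < d * e} \<times> {s. [s = c - b] (mod 5)}"
      by (auto intro: c7 c8)
  qed auto
  have w: "W ((\<lambda>((d, e), s). (d, s, e)) ((d, e), s)) = nat (d * e + s\<^sup>2)"
    "W ((\<lambda>((d, e), s). (d, s - d, 2 * s - d + e)) ((d, e), s)) = nat (d * e + s\<^sup>2)"
    "W ((\<lambda>((d, e), s). (d - 2 * s - e, s + e, e)) ((d, e), s)) = nat (d * e + s\<^sup>2)" for d e s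
    by (auto simp: W_def power2_eq_square algebra_simps)
  note r1 = lambert_mult_theta[OF b1 w(1)] and r2 = lambert_mult_theta[OF b2 w(2)]
    and r3 = lambert_mult_theta[OF b3 w(3)]
  have "(X1 - X2) \<union> (X2 - X1) = X3"
  proof -
    have "(0 < (d + 2 * s - e) * e) = ((0 < d * e) \<noteq> (0 < d * (e - d - 2 * s)))" if "(d, s, e) \<in> X" for d s e
    proof -
      have "[d = a] (mod 5)" "[s = c] (mod 5)" "[e = b] (mod 5)" using that by (auto simp: X_def)
      then have "[d + 2 * s - e = a + 2 * c - b] (mod 5)" "[d = a] (mod 5)" "[e = b] (mod 5)"
        by (auto intro: cong_diff cong_add cong_scalar_left)
      then have "d \<noteq> 0" "e \<noteq> 0" "d + 2 * s - e \<noteq> 0"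
        using assms by (auto dest: cong_sym)
      then show ?thesis by (auto simp: zero_less_mult_iff)
    qed
    then show ?thesis by (auto simp: X1_def X2_def X3_def)
  qed
  then show ?thesis
    using gf_symdiff[OF r1(2) r2(2)] by (simp only: r1(1) r2(1) r3(1))
qed

abbreviation "\<theta>\<^sub>1 \<equiv> theta 1"
abbreviation "\<theta>\<^sub>2 \<equiv> theta 2"

text \<open>The case \<open>a = 1\<close>, \<open>b = 2\<close>, \<open>c = 0\<close> of the
  three-term relation, whose middle product is diagonal. With \<open>lambert_13\<close> it forms a
  linear system for the two Lambert series.\<close>

lemma lambert_12: "lambert 1 2 + \<theta>\<^sub>1\<^sup>2 = lambert 1 3 * \<theta>\<^sub>2"
proof -
  have "lambert (- 1) 2 = lambert 1 3"
    using lambert_uminus[of 1 "-2"] lambert_cong[of 1 1 "-2" 3] by (simp add: cong_def)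
  then show ?thesis
    using lambert_theta_three_term[of 1 2 0] lambert_diag[of 1] theta_uminus[of 2] theta_0
    by (simp add: cong_def power2_eq_square)
qed

text \<open>For \<open>a = 1\<close>, \<open>b = 3\<close>, \<open>c = 0\<close> it is the Lambert
  series on the right that becomes diagonal, since \<open>- 2\<close> and 3 agree modulo 5.\<close>

lemma lambert_13: "lambert 1 3 + lambert 1 2 * \<theta>\<^sub>1 = \<theta>\<^sub>2\<^sup>2"
proof -
  have "lambert (- 2) 3 = theta 3"
    using lambert_diag[of 3] lambert_cong[of "-2" 3 3 3] by (simp add: cong_def)
  moreover have "theta 3 = \<theta>\<^sub>2"
    using theta_uminus[of 2] theta_cong[of "-2" 3] by (simp add: cong_def)
  ultimately show ?thesis
    using lambert_theta_three_term[of 1 3 0] theta_uminus[of 3] theta_0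
    by (simp add: cong_def power2_eq_square)
qed

lemma int_mod_5_iff:
  "int n mod 5 = 1 \<longleftrightarrow> n mod 5 = 1" "int n mod 5 = 2 \<longleftrightarrow> n mod 5 = 2" "int n mod 5 = 3 \<longleftrightarrow> n mod 5 = 3"
  "(- int n) mod 5 = 1 \<longleftrightarrow> n mod 5 = 4" "(- int n) mod 5 = 2 \<longleftrightarrow> n mod 5 = 3"
  "(- int n) mod 5 = 3 \<longleftrightarrow> n mod 5 = 2"
proof -
  have "int n mod 5 = int (n mod 5)" by (simp add: zmod_int)
  moreover have "n mod 5 < 5" by simp
  then have "n mod 5 \<in> {0, 1, 2, 3, 4}" by auto
  ultimately show "int n mod 5 = 1 \<longleftrightarrow> n mod 5 = 1" "int n mod 5 = 2 \<longleftrightarrow> n mod 5 = 2"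
    "int n mod 5 = 3 \<longleftrightarrow> n mod 5 = 3" "(- int n) mod 5 = 1 \<longleftrightarrow> n mod 5 = 4"
    "(- int n) mod 5 = 2 \<longleftrightarrow> n mod 5 = 3" "(- int n) mod 5 = 3 \<longleftrightarrow> n mod 5 = 2"
    by (elim insertE emptyE; simp add: zmod_zminus1_eq_if)+
qed

text \<open>If 5 does not divide \<open>s\<close>, exactly one of \<open>s\<close> and
  \<open>- s\<close> is congruent to 1 or 2; \<open>?g\<close> picks that sign.\<close>

lemma gf_squares_coprime_5:
  "gf {s :: nat. \<not> 5 dvd s} (\<lambda>s. s\<^sup>2) = \<theta>\<^sub>1 + \<theta>\<^sub>2"
proof -
  let ?A = "{s :: int. [s = 1] (mod 5)} \<union> {s. [s = 2] (mod 5)}"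
  let ?g = "\<lambda>s. if s mod 5 = 1 \<or> s mod 5 = 2 then int s else - int s"
  have "gf {s :: nat. \<not> 5 dvd s} (\<lambda>s. s\<^sup>2) = gf ?A (\<lambda>s. nat (s\<^sup>2))"
  proof (rule gf_reindex)
    show "bij_betw (\<lambda>s. nat \<bar>s\<bar>) ?A {s :: nat. \<not> 5 dvd s}"
    proof (rule bij_betw_byWitness[where f' = ?g])
      show "\<forall>s\<in>?A. ?g (nat \<bar>s\<bar>) = s"
      proof
        fix s assume "s \<in> ?A"
        then show "?g (nat \<bar>s\<bar>) = s"
          by (cases s rule: int_cases2) (auto simp: cong_def int_mod_5_iff)
      qed
      show "(\<lambda>s. nat \<bar>s\<bar>) ` ?A \<subseteq> {s :: nat. \<not> 5 dvd s}"
      proof (rule image_subsetI)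
        fix s assume "s \<in> ?A"
        then show "nat \<bar>s\<bar> \<in> {s :: nat. \<not> 5 dvd s}"
          by (cases s rule: int_cases2) (auto simp: cong_def int_mod_5_iff dvd_eq_mod_eq_0)
      qed
      show "?g ` {s :: nat. \<not> 5 dvd s} \<subseteq> ?A"
      proof (rule image_subsetI)
        fix s :: nat assume "s \<in> {s. \<not> 5 dvd s}"
        then have "s mod 5 \<noteq> 0" "s mod 5 < 5" by (simp_all add: dvd_eq_mod_eq_0)
        then have "s mod 5 = 1 \<or> s mod 5 = 2 \<or> s mod 5 = 3 \<or> s mod 5 = 4" by linarith
        then consider "s mod 5 = 1" | "s mod 5 = 2" | "s mod 5 = 3" | "s mod 5 = 4" by blast
        then show "?g s \<in> ?A"
          by cases (simp_all add: cong_def int_mod_5_iff)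
      qed
    qed auto
  qed (metis abs_ge_zero nat_power_eq power2_abs)
  also have "\<dots> = \<theta>\<^sub>1 + \<theta>\<^sub>2"
    unfolding theta_def
    by (rule gf_Un[OF finite_fibres_square finite_fibres_square]) (auto simp: cong_def)
  finally show ?thesis .
qed

text \<open>The common sign of \<open>d\<close> and \<open>e\<close> is normalised by making
  \<open>d\<close> congruent to 1; then \<open>e\<close> is congruent to 2 or 3.\<close>

lemma gf_pairs_eq_lambert:
  "gf {(d :: nat, e :: nat). d mod 5 \<in> {1, 4} \<and> e mod 5 \<in> {2, 3}} (\<lambda>(d, e). d * e) =
    lambert 1 2 + lambert 1 3"
proof -
  let ?A = "\<lambda>b :: int. {(d, e). [d = 1] (mod 5) \<and> [e = b] (mod 5) \<and> 0 < d * e}"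
  let ?g = "\<lambda>(d, e). if d mod 5 = 1 then (int d, int e) else (- int d, - int e)"
  have "gf {(d :: nat, e :: nat). d mod 5 \<in> {1, 4} \<and> e mod 5 \<in> {2, 3}} (\<lambda>(d, e). d * e) =
      gf (?A 2 \<union> ?A 3) (\<lambda>(d, e). nat (d * e))"
  proof (rule gf_reindex)
    show "bij_betw (\<lambda>(d, e). (nat \<bar>d\<bar>, nat \<bar>e\<bar>)) (?A 2 \<union> ?A 3)
        {(d, e). d mod 5 \<in> {1, 4} \<and> e mod 5 \<in> {2, 3}}"
    proof (rule bij_betw_byWitness[where f' = ?g])
      show "\<forall>z\<in>?A 2 \<union> ?A 3. ?g ((\<lambda>(d, e). (nat \<bar>d\<bar>, nat \<bar>e\<bar>)) z) = z"
      proof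
        fix z assume z: "z \<in> ?A 2 \<union> ?A 3"
        obtain d e where "z = (d, e)" by fastforce
        with z show "?g ((\<lambda>(d, e). (nat \<bar>d\<bar>, nat \<bar>e\<bar>)) z) = z"
          by (cases d rule: int_cases2; cases e rule: int_cases2)
            (auto simp: cong_def int_mod_5_iff zero_less_mult_iff)
      qed
      show "(\<lambda>(d, e). (nat \<bar>d\<bar>, nat \<bar>e\<bar>)) ` (?A 2 \<union> ?A 3) \<subseteq>
          {(d, e). d mod 5 \<in> {1, 4} \<and> e mod 5 \<in> {2, 3}}"
      proof (rule image_subsetI)
        fix z assume z: "z \<in> ?A 2 \<union> ?A 3"
        obtain d e where "z = (d, e)" by fastforce
        with z show "(\<lambda>(d, e). (nat \<bar>d\<bar>, nat \<bar>e\<bar>)) z \<in> {(d, e). d mod 5 \<in> {1, 4} \<and> e mod 5 \<in> {2, 3}}"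
          by (cases d rule: int_cases2; cases e rule: int_cases2)
            (auto simp: cong_def int_mod_5_iff zero_less_mult_iff)
      qed
      show "?g ` {(d, e). d mod 5 \<in> {1, 4} \<and> e mod 5 \<in> {2, 3}} \<subseteq> ?A 2 \<union> ?A 3"
      proof (rule image_subsetI)
        fix z :: "nat \<times> nat" assume z: "z \<in> {(d, e). d mod 5 \<in> {1, 4} \<and> e mod 5 \<in> {2, 3}}"
        obtain d e where [simp]: "z = (d, e)" by fastforce
        have pos: "0 < d" "0 < e" using z by (auto intro!: Nat.gr0I)
        from z consider "d mod 5 = 1" "e mod 5 = 2" | "d mod 5 = 1" "e mod 5 = 3"
          | "d mod 5 = 4" "e mod 5 = 2" | "d mod 5 = 4" "e mod 5 = 3" by auto
        then show "?g z \<in> ?A 2 \<union> ?A 3"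
          using pos by cases (simp_all add: cong_def int_mod_5_iff)
      qed
    qed auto
  qed (auto simp: zero_less_mult_iff nat_mult_distrib[symmetric] mult_neg_neg)
  also have "\<dots> = lambert 1 2 + lambert 1 3"
    unfolding lambert_def
    by (rule gf_Un[OF finite_fibres_lambert finite_fibres_lambert]) (auto simp: cong_def)
  finally show ?thesis .
qed

section \<open>Euler products and the pentagonal number theorem\<close>

lemma prod_one_plus_X_power_high:
  fixes f :: "'a :: comm_ring_1 fps"
  assumes "finite B" "\<And>k. k \<in> B \<Longrightarrow> n < k" "i \<le> n"
  shows "(f * (\<Prod>k\<in>B. 1 + fps_X ^ k)) $ i = f $ i"
  using assms
proof (induction B arbitrary: f rule: finite_induct)
  case (insert k B)
  have "(f * (\<Prod>k\<in>insert k B. 1 + fps_X ^ k)) $ i = (f * (1 + fps_X ^ k) * (\<Prod>k\<in>B. 1 + fps_X ^ k)) $ i"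
    using insert by (simp add: mult_ac)
  also have "\<dots> = (f * (1 + fps_X ^ k)) $ i"
    using insert by auto
  also have "\<dots> = f $ i"
    using insert.prems(1)[of k] insert.prems(2) by (simp add: distrib_left fps_X_power_mult_right_nth not_le)
  finally show ?case .
qed auto

text \<open>The infinite product of \<open>1 + q^k\<close> over positive \<open>k\<close> in
  \<open>S\<close>, encoded by coefficients: factors with \<open>k > n\<close> do not affect that of
  \<open>q^n\<close>. In characteristic 2 it is also the product of \<open>1 - q^k\<close>.\<close>

definition eta :: "nat set \<Rightarrow> bit fps" where
  "eta S = Abs_fps (\<lambda>n. (\<Prod>k\<in>S \<inter> {1..n}. 1 + fps_X ^ k) $ n)"

lemma eta_nth:
  assumes "n \<le> N"
  shows "eta S $ n = (\<Prod>k\<in>S \<inter> {1..N}. 1 + fps_X ^ k) $ n"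
proof -
  have "S \<inter> {1..N} = (S \<inter> {1..n}) \<union> (S \<inter> {n<..N})" using assms by auto
  then have "(\<Prod>k\<in>S \<inter> {1..N}. 1 + fps_X ^ k :: bit fps) =
      (\<Prod>k\<in>S \<inter> {1..n}. 1 + fps_X ^ k) * (\<Prod>k\<in>S \<inter> {n<..N}. 1 + fps_X ^ k)"
    by (simp add: prod.union_disjoint disjoint_iff)
  then show ?thesis
    using prod_one_plus_X_power_high[of "S \<inter> {n<..N}" n n "\<Prod>k\<in>S \<inter> {1..n}. 1 + fps_X ^ k :: bit fps"]
    by (simp add: eta_def)
qed

lemma eta_mult:
  assumes "S \<inter> T = {}"
  shows "eta (S \<union> T) = eta S * eta T"
proof (rule fps_ext)
  fix n
  have "(S \<union> T) \<inter> {1..n} = (S \<inter> {1..n}) \<union> (T \<inter> {1..n})" by auto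
  then have "(\<Prod>k\<in>(S \<union> T) \<inter> {1..n}. 1 + fps_X ^ k :: bit fps) =
      (\<Prod>k\<in>S \<inter> {1..n}. 1 + fps_X ^ k) * (\<Prod>k\<in>T \<inter> {1..n}. 1 + fps_X ^ k)"
    using assms by (simp add: prod.union_disjoint disjoint_iff)
  then show "eta (S \<union> T) $ n = (eta S * eta T) $ n"
    by (simp add: eta_nth[of n n "S \<union> T"] fps_mult_nth eta_nth[where N = n])
qed

lemma fps_compose_X_power_nth:
  assumes "0 < m"
  shows "(f oo fps_X ^ m :: 'a :: comm_ring_1 fps) $ n = (if m dvd n then f $ (n div m) else 0)"
proof -
  have "(f oo fps_X ^ m) $ n = (\<Sum>i = 0..n. f $ i * (if n = m * i then 1 else 0))"
    unfolding fps_compose_nth power_mult[symmetric] by (simp only: fps_X_power_nth)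
  also have "\<dots> = (if m dvd n then f $ (n div m) else 0)"
  proof (cases "m dvd n")
    case True
    then have "(\<Sum>i = 0..n. f $ i * (if n = m * i then 1 else 0)) = (\<Sum>i \<in> {n div m}. f $ i * (if n = m * i then 1 else 0))"
      using assms by (intro sum.mono_neutral_right) auto
    then show ?thesis using True by simp
  qed (auto intro!: sum.neutral)
  finally show ?thesis .
qed

lemma eta_image_mult:
  assumes "0 < m"
  shows "eta ((*) m ` S) = eta S oo fps_X ^ m"
proof (rule fps_ext)
  fix n
  have X0: "(fps_X ^ m :: bit fps) $ 0 = 0" using assms by simp
  have "(*) m ` S \<inter> {1..m * n} = (*) m ` (S \<inter> {1..n})"
    using assms by auto
  then have "(\<Prod>k\<in>(*) m ` S \<inter> {1..m * n}. 1 + fps_X ^ k :: bit fps) =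
      (\<Prod>k\<in>S \<inter> {1..n}. 1 + fps_X ^ (m * k))"
    using assms by (simp add: prod.reindex inj_on_def)
  also have "\<dots> = (\<Prod>k\<in>S \<inter> {1..n}. 1 + fps_X ^ k) oo fps_X ^ m"
    using X0 by (simp add: fps_compose_prod_distrib fps_compose_add_distrib fps_compose_power[symmetric] power_mult)
  finally have "eta ((*) m ` S) $ n = ((\<Prod>k\<in>S \<inter> {1..n}. 1 + fps_X ^ k) oo fps_X ^ m) $ n"
    using assms by (simp add: eta_nth[of n "m * n"])
  also have "\<dots> = (eta S oo fps_X ^ m) $ n"
    using assms by (simp add: fps_compose_X_power_nth eta_nth[of "n div m" n])
  finally show "eta ((*) m ` S) $ n = (eta S oo fps_X ^ m) $ n" .
qed

abbreviation euler :: "bit fps" where "euler \<equiv> eta UNIV"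

section \<open>The pentagonal number theorem modulo 2 through Shanks' finite identity\<close>

lemma telescope_char_2: "(\<Sum>s\<le>n. a s + a (Suc s)) = a 0 + (a (Suc n) :: bit fps)"
proof (induction n)
  case (Suc n)
  then show ?case using bit_fps_double[of "a (Suc n)"] by (simp add: algebra_simps)
qed simp

text \<open>Shanks' sums: the summand at 0 is the truncated Euler product, while the whole sum is a
  truncated pentagonal series.\<close>

definition shanks :: "nat \<Rightarrow> bit fps" where
  "shanks n = (\<Sum>s\<le>n. (\<Prod>k\<in>{s<..n}. 1 + fps_X ^ k) * fps_X ^ (s * n + s * (s + 1) div 2))"

text \<open>The change of the old summands telescopes to one monomial; the new summand
  \<open>s = Suc n\<close> supplies the other.\<close>

lemma shanks_Suc:
  "shanks (Suc n) = shanks n + fps_X ^ (Suc n * (3 * Suc n - 1) div 2) + fps_X ^ (Suc n * (3 * Suc n + 1) div 2)"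
proof -
  define tri where "tri s = s * (s + 1) div 2" for s :: nat
  have tri: "tri 0 = 0" "tri (Suc s) = tri s + Suc s" for s by (simp_all add: tri_def)
  have tri2: "2 * tri s = s * (s + 1)" for s by (induction s) (simp_all add: tri)
  define P where "P s = (\<Prod>k\<in>{s<..n}. 1 + fps_X ^ k :: bit fps)" for s
  \<comment> \<open>Chosen so that the summand at \<open>s\<close> changes by
    \<open>a s + a (Suc s)\<close>. The value 0 at \<open>s = 0\<close> fits the formula for
    positive \<open>s\<close>, because \<open>1 + q^0 = 0\<close>.\<close>
  define a where "a s = (case s of 0 \<Rightarrow> 0 | Suc r \<Rightarrow> P r * fps_X ^ (tri s + s * n))" for s
  have a: "a s = (1 + fps_X ^ s) * P s * fps_X ^ (tri s + s * n)" if "s \<le> n" for s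
  proof (cases s)
    case 0
    then show ?thesis using bit_fps_double[of 1] by (simp add: a_def)
  next
    case (Suc r)
    then have "{r<..n} = insert s {s<..n}" using that by auto
    then have "P r = (1 + fps_X ^ s) * P s" by (simp add: P_def)
    then show ?thesis using Suc by (simp add: a_def)
  qed
  have "shanks (Suc n) = (\<Sum>s\<le>n. P s * (1 + fps_X ^ Suc n) * fps_X ^ (s * Suc n + tri s)) + fps_X ^ (Suc n * Suc n + tri (Suc n))"
  proof -
    have "{s<..Suc n} = insert (Suc n) {s<..n}" if "s \<le> n" for s using that by auto
    then have "(\<Prod>k\<in>{s<..Suc n}. 1 + fps_X ^ k :: bit fps) = P s * (1 + fps_X ^ Suc n)" if "s \<le> n" for s
      using that by (simp add: P_def mult.commute)
    then show ?thesis unfolding shanks_def tri_def by simp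
  qed
  also have "(\<Sum>s\<le>n. P s * (1 + fps_X ^ Suc n) * fps_X ^ (s * Suc n + tri s)) =
      (\<Sum>s\<le>n. P s * fps_X ^ (s * n + tri s)) + (\<Sum>s\<le>n. a s + a (Suc s))"
    unfolding sum.distrib[symmetric]
  proof (rule sum.cong)
    fix s assume "s \<in> {..n}"
    then have "a s + a (Suc s) = (1 + fps_X ^ s) * P s * fps_X ^ (tri s + s * n) + P s * fps_X ^ (tri (Suc s) + Suc s * n)"
      using a[of s] by (simp add: a_def[of "Suc s"])
    also have "fps_X ^ (tri (Suc s) + Suc s * n) = (fps_X ^ Suc n * fps_X ^ s * fps_X ^ (tri s + s * n) :: bit fps)"
      by (simp add: tri algebra_simps flip: power_add)
    finally show "P s * (1 + fps_X ^ Suc n) * fps_X ^ (s * Suc n + tri s) = P s * fps_X ^ (s * n + tri s) + (a s + a (Suc s))"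
      using bit_fps_double[of "P s * fps_X ^ (s * n + tri s)"]
      by (simp add: algebra_simps power_add)
  qed simp
  also have "(\<Sum>s\<le>n. a s + a (Suc s)) = fps_X ^ (tri (Suc n) + Suc n * n)"
    by (simp add: telescope_char_2) (simp add: a_def P_def)
  also have "(\<Sum>s\<le>n. P s * fps_X ^ (s * n + tri s)) = shanks n"
    by (simp add: shanks_def P_def tri_def)
  also have "tri (Suc n) + Suc n * n = Suc n * (3 * Suc n - 1) div 2"
    using tri2[of "Suc n"] by (simp add: algebra_simps)
  also have "Suc n * Suc n + tri (Suc n) = Suc n * (3 * Suc n + 1) div 2"
    using tri2[of "Suc n"] by (simp add: algebra_simps)
  finally show ?thesis .
qed

text \<open>The generalised pentagonal numbers. The halving is exact and the value nonnegative, so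
  \<open>div\<close> and \<open>nat\<close> lose nothing.\<close>

definition pent :: "int \<Rightarrow> nat" where
  "pent s = nat (s * (3 * s - 1) div 2)"

lemma pent_of_nat: "pent (int n) = n * (3 * n - 1) div 2" "pent (- int n) = n * (3 * n + 1) div 2"
proof -
  have "int n * (3 * int n - 1) = int (n * (3 * n - 1))" by (cases n) (auto simp: algebra_simps)
  then show "pent (int n) = n * (3 * n - 1) div 2" unfolding pent_def by (simp only:)
  have "- int n * (3 * (- int n) - 1) = int (n * (3 * n + 1))" by (simp add: algebra_simps)
  then show "pent (- int n) = n * (3 * n + 1) div 2"  unfolding pent_def by (simp only:)
qed

lemma le_pent: "\<bar>s\<bar> \<le> int (pent s)"
proof -
  obtain n where "s = int n \<or> s = - int n" by (cases s rule: int_cases2) auto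
  moreover have "n \<le> n * (3 * n - 1) div 2" "n \<le> n * (3 * n + 1) div 2" 
    by (cases n; simp add: algebra_simps)+
  ultimately show ?thesis by (auto simp: pent_of_nat)
qed

lemma shanks_eq: "shanks n = (\<Sum>s\<in>{- int n..int n}. fps_X ^ pent s)"
proof (induction n)
  case (Suc n)
  have "{- int (Suc n)..int (Suc n)} = insert (int (Suc n)) (insert (- int (Suc n)) {- int n..int n})" by auto
  then show ?case
    using Suc unfolding shanks_Suc pent_of_nat[symmetric] by (simp only:) (simp add: add_ac)
qed (simp add: shanks_def pent_def)

lemma finite_fibres_pent: "finite_fibres A pent"
  unfolding finite_fibres_def
proof
  fix n
  have "{s \<in> A. pent s = n} \<subseteq> {- int n..int n}"
    using le_pent by (auto simp: abs_le_iff) (metis abs_le_iff minus_le_iff)+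
  then show "finite {s \<in> A. pent s = n}" by (rule finite_subset) simp
qed

lemma pentagonal: "euler = gf UNIV pent"
proof (rule fps_ext)
  fix n
  have "euler $ n = (\<Prod>k\<in>{0<..Suc n}. 1 + fps_X ^ k) $ n"
    by (subst eta_nth[of n "Suc n"]) (simp_all add: atLeastSucAtMost_greaterThanAtMost del: prod.cl_ivl_Suc)
  also have "\<dots> = shanks (Suc n) $ n"
  proof -
    have "shanks (Suc n) = (\<Prod>k\<in>{0<..Suc n}. 1 + fps_X ^ k) + (\<Sum>s\<in>{1..Suc n}. (\<Prod>k\<in>{s<..Suc n}. 1 + fps_X ^ k) * fps_X ^ (s * Suc n + s * (s + 1) div 2))"
      unfolding shanks_def by (subst atMost_atLeast0, subst sum.atLeast_Suc_atMost) auto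
    \<comment> \<open>A summand with \<open>s \<ge> 1\<close> has only exponents above
      \<open>n\<close>, so the coefficient at \<open>n\<close> sees the truncated product
      alone.\<close>
    moreover have "((\<Prod>k\<in>{s<..Suc n}. 1 + fps_X ^ k) * fps_X ^ (s * Suc n + s * (s + 1) div 2) :: bit fps) $ n = 0" if "1 \<le> s" for s
    proof -
      have "n < s * Suc n + s * (s + 1) div 2" using that by (cases s) auto
      then show ?thesis by (simp add: fps_X_power_mult_right_nth)
    qed
    then have "(\<Sum>s\<in>{1..Suc n}. (\<Prod>k\<in>{s<..Suc n}. 1 + fps_X ^ k) * fps_X ^ (s * Suc n + s * (s + 1) div 2) :: bit fps) $ n = 0"
      unfolding fps_sum_nth by (intro sum.neutral) auto
    ultimately show ?thesis by (simp only: fps_add_nth add_0_right)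
  qed
  also have "\<dots> = (\<Sum>s\<in>{- int (Suc n)..int (Suc n)}. of_bool (pent s = n))"
    unfolding shanks_eq by (simp add: fps_sum_nth fps_X_power_iff of_bool_def eq_commute)
  also have "\<dots> = of_nat (card {s \<in> {- int (Suc n)..int (Suc n)}. pent s = n})"
    by (simp add: of_bool_def sum.If_cases Int_def)
  also have "{s \<in> {- int (Suc n)..int (Suc n)}. pent s = n} = {s \<in> UNIV. pent s = n}"
    using le_pent by (auto simp: abs_le_iff) (smt (verit) le_pent)+
  finally show "euler $ n = gf UNIV pent $ n" by (simp add: gf_nth)
qed

section \<open>Logarithmic derivative and regular partitions\<close>

text \<open>The operator \<open>q d/dq\<close>. Modulo 2 it keeps exactly the terms of odd exponent,
  so \<open>f + q_deriv f\<close> is the even part of \<open>f\<close>.\<close>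

definition q_deriv :: "bit fps \<Rightarrow> bit fps" where
  "q_deriv f = fps_X * fps_deriv f"

lemma q_deriv_nth: "q_deriv f $ n = of_nat n * f $ n"
  by (cases n) (simp_all add: q_deriv_def)

lemma q_deriv_mult: "q_deriv (f * g) = q_deriv f * g + f * q_deriv g"
  by (simp add: q_deriv_def algebra_simps)

lemma q_deriv_add: "q_deriv (f + g) = q_deriv f + q_deriv g"
  by (simp add: q_deriv_def algebra_simps)

lemma q_deriv_prod:
  fixes L :: "nat \<Rightarrow> bit fps"
  assumes "finite A" "\<And>k. k \<in> A \<Longrightarrow> q_deriv (1 + fps_X ^ k) = (1 + fps_X ^ k) * L k"
  shows "q_deriv (\<Prod>k\<in>A. 1 + fps_X ^ k) = (\<Prod>k\<in>A. 1 + fps_X ^ k) * (\<Sum>k\<in>A. L k)"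
  using assms
proof (induction A rule: finite_induct)
  case (insert k A)
  then show ?case by (simp add: q_deriv_mult) (simp add: algebra_simps)
qed (simp add: q_deriv_def)

text \<open>The logarithmic derivative of \<open>euler\<close>: the factor \<open>1 + q^k\<close>
  contributes \<open>k q^k / (1 + q^k)\<close>, which survives modulo 2 only for odd
  \<open>k\<close>.\<close>

definition log_deriv :: "bit fps" where
  "log_deriv = gf {(d, e). 0 < d \<and> 0 < e \<and> odd d} (\<lambda>(d, e). d * e)"

lemma finite_fibres_mult_nat: "A \<subseteq> {(d, e). 0 < d \<and> 0 < e} \<Longrightarrow> finite_fibres A (\<lambda>(d :: nat, e). d * e)"
  unfolding finite_fibres_def
proof
  fix n assume A: "A \<subseteq> {(d, e). 0 < d \<and> 0 < e}"
  have "{z \<in> A. (\<lambda>(d :: nat, e). d * e) z = n} \<subseteq> {..n} \<times> {..n}"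
    using A by auto
  then show "finite {z \<in> A. (\<lambda>(d :: nat, e). d * e) z = n}" by (rule finite_subset) simp
qed

lemma q_deriv_one_plus_X_power:
  assumes "0 < k"
  shows "q_deriv (1 + fps_X ^ k) = (1 + fps_X ^ k) * (of_nat k * gf {e. 0 < e} (\<lambda>e. k * e))"
proof -
  have g: "gf {e. 0 < e} (\<lambda>e. k * e) $ n = of_bool (0 < n \<and> k dvd n)" for n
  proof -
    have "{e \<in> {e. 0 < e}. k * e = n} = (if 0 < n \<and> k dvd n then {n div k} else {})"
      using assms by (auto elim!: dvdE)
    then show ?thesis by (simp add: gf_nth)
  qed
  \<comment> \<open>The geometric series for \<open>q^k / (1 + q^k)\<close>; signs are immaterial
    modulo 2.\<close>
  have "(1 + fps_X ^ k) * gf {e. 0 < e} (\<lambda>e. k * e) = fps_X ^ k"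
  proof (rule fps_ext)
    fix n
    have "k dvd n - k \<longleftrightarrow> k dvd n" if "k \<le> n" using that by (simp add: dvd_minus_self)
    then show "((1 + fps_X ^ k) * gf {e. 0 < e} (\<lambda>e. k * e)) $ n = (fps_X ^ k :: bit fps) $ n"
      using assms by (auto simp: distrib_right fps_X_power_mult_nth g not_less dest: dvd_imp_le)
  qed
  moreover have "q_deriv (1 + fps_X ^ k) = of_nat k * fps_X ^ k"
    by (rule fps_ext) (auto simp: q_deriv_nth fps_of_nat[symmetric])
  ultimately show ?thesis by (simp add: mult_ac)
qed

lemma q_deriv_euler: "q_deriv euler = euler * log_deriv"
proof (rule fps_ext)
  fix n
  let ?P = "\<lambda>n. \<Prod>k\<in>{1..n}. 1 + fps_X ^ k :: bit fps"
  let ?L = "\<lambda>k. of_nat k * gf {e. 0 < e} (\<lambda>e. k * e)"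
  \<comment> \<open>A pair of positive numbers with \<open>d * e = i \<le> n\<close> has
    \<open>d \<le> n\<close>, so the factors up to \<open>n\<close> determine these
    coefficients.\<close>
  have L: "(\<Sum>k\<in>{1..n}. ?L k) $ i = log_deriv $ i" if "i \<le> n" for i
  proof -
    have "{z \<in> {(d, e). 0 < d \<and> 0 < e \<and> odd d}. (\<lambda>(d, e). d * e) z = i} =
        Sigma {d \<in> {1..n}. odd d} (\<lambda>d. {e \<in> {e. 0 < e}. d * e = i})"
    proof -
      have "d \<le> n" if "d * e = i" "0 < e" for d e using that \<open>i \<le> n\<close>
        by (metis dvd_imp_le dvd_triv_left le_trans mult_eq_0_iff not_gr_zero zero_le)
      moreover have "Suc 0 \<le> d" if "odd d" for d :: nat using odd_pos[OF that] by simp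
      ultimately show ?thesis by (auto intro: odd_pos)
    qed
    moreover have "finite {e \<in> {e. 0 < e}. d * e = i}" if "odd d" for d
      using that odd_pos[OF that] by (auto intro!: finite_subset[of _ "{..i}"])
    ultimately have "log_deriv $ i = (\<Sum>d\<in>{d \<in> {1..n}. odd d}. of_nat (card {e \<in> {e. 0 < e}. d * e = i}))"
      by (simp add: log_deriv_def gf_nth)
    also have "\<dots> = (\<Sum>d\<in>{1..n}. ?L d $ i)"
      by (rule sum.mono_neutral_cong_left) (auto simp: gf_nth of_nat_bit fps_of_nat[symmetric])
    finally show ?thesis by (simp add: fps_sum_nth)
  qed
  have "q_deriv euler $ n = q_deriv (?P n) $ n"
    by (simp add: q_deriv_nth eta_def)
  also have "q_deriv (?P n) = ?P n * (\<Sum>k\<in>{1..n}. ?L k)"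
    by (rule q_deriv_prod) (simp_all add: q_deriv_one_plus_X_power)
  also have "\<dots> $ n = (euler * log_deriv) $ n"
    unfolding fps_mult_nth
  proof (rule sum.cong)
    fix i assume "i \<in> {0..n}"
    then show "?P n $ i * (\<Sum>k\<in>{1..n}. ?L k) $ (n - i) = euler $ i * log_deriv $ (n - i)"
      using L[of "n - i"] by (simp add: eta_nth[of i n])
  qed simp
  finally show "q_deriv euler $ n = (euler * log_deriv) $ n" .
qed

definition squares :: "bit fps" where
  "squares = gf {s :: nat. 0 < s} (\<lambda>s. s\<^sup>2)"

text \<open>Among all divisor pairs only \<open>d = e\<close> survives the swap. Pairs with even
  \<open>d\<close> are arbitrary pairs of doubled weight, hence give \<open>squares\<^sup>2\<close>
  by Frobenius; those with odd \<open>d\<close> are the rest.\<close>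

lemma log_deriv_eq: "log_deriv = squares + squares\<^sup>2"
proof -
  let ?w = "\<lambda>(d :: nat, e). d * e"
  let ?A = "{(d :: nat, e :: nat). 0 < d \<and> 0 < e}"
  have all: "gf ?A ?w = squares"
  proof -
    have "gf ?A ?w = gf {z \<in> ?A. prod.swap z = z} ?w"
      by (rule gf_involution[where i = prod.swap, OF finite_fibres_mult_nat]) (auto simp: mult.commute)
    also have "\<dots> = squares" unfolding squares_def
    proof (rule gf_reindex)
      show "bij_betw (\<lambda>s. (s, s)) {s. 0 < s} {z \<in> ?A. prod.swap z = z}"
        by (rule bij_betw_byWitness[where f' = fst]) (auto simp: swap_eq_self_iff simp del: swap_simp)
    qed (simp add: power2_eq_square)
    finally show ?thesis .
  qed
  have "gf ?A ?w = gf {(d, e). 0 < d \<and> 0 < e \<and> odd d} ?w + gf {(d, e). 0 < d \<and> 0 < e \<and> even d} ?w"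
    by (subst gf_Un[symmetric]) (auto intro!: finite_fibres_mult_nat gf_cong)
  also have "gf {(d, e). 0 < d \<and> 0 < e \<and> even d} ?w = gf ?A (\<lambda>z. 2 * ?w z)"
    by (rule gf_reindex[where f = "\<lambda>(d, e). (2 * d, e)"], rule bij_betw_byWitness[where f' = "\<lambda>(d, e). (d div 2, e)"]) auto
  also have "\<dots> = (gf ?A ?w)\<^sup>2"
    by (rule gf_square[symmetric]) (auto intro!: finite_fibres_mult_nat)
  finally have "squares = log_deriv + squares\<^sup>2" by (simp only: all log_deriv_def)
  then show ?thesis
    by (metis add.assoc add_0_right bit_fps_double)
qed

section \<open>Partitions with prescribed parts, and the 25-regular case\<close>

definition part_gf :: "nat set \<Rightarrow> bit fps" where
  "part_gf S = gf {M. set_mset M \<subseteq> S} sum_mset"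

lemma finite_fibres_partitions: "0 \<notin> S \<Longrightarrow> finite_fibres {M. set_mset M \<subseteq> S} sum_mset"
  unfolding finite_fibres_def
proof
  fix n assume "0 \<notin> S"
  then have "{M \<in> {M. set_mset M \<subseteq> S}. sum_mset M = n} \<subseteq> partitions n"
    by (auto simp: partitions_def) (metis gr0I subsetD)
  then show "finite {M \<in> {M. set_mset M \<subseteq> S}. sum_mset M = n}"
    by (rule finite_subset) (rule finite_partitions)
qed

lemma gf_add_const: "gf A (\<lambda>x. k + w x) = fps_X ^ k * gf A w"
proof (rule fps_ext)
  fix n
  have "{x \<in> A. k + w x = n} = (if k \<le> n then {x \<in> A. w x = n - k} else {})" by auto
  then show "gf A (\<lambda>x. k + w x) $ n = (fps_X ^ k * gf A w) $ n"
    by (simp add: gf_nth fps_X_power_mult_nth)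
qed

text \<open>Removing one copy of \<open>k\<close> from a multiset containing it lowers the weight by
  \<open>k\<close>; the multisets without \<open>k\<close> have all parts in
  \<open>S\<close>.\<close>

lemma part_gf_insert:
  assumes "0 \<notin> insert k S" "k \<notin> S"
  shows "part_gf (insert k S) * (1 + fps_X ^ k) = part_gf S"
proof -
  let ?A = "{M. set_mset M \<subseteq> insert k S}"
  have "part_gf (insert k S) = gf {M. set_mset M \<subseteq> S} sum_mset + gf {M \<in> ?A. k \<in># M} sum_mset"
    unfolding part_gf_def
    by (subst gf_Un[symmetric]) (use assms in \<open>auto intro!: finite_fibres_subset[OF finite_fibres_partitions[of "insert k S"]] gf_cong\<close>)
  also have "gf {M \<in> ?A. k \<in># M} sum_mset = gf ?A (\<lambda>M. k + sum_mset M)"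
    by (rule gf_reindex[where f = "add_mset k"], rule bij_betw_byWitness[where f' = "\<lambda>M. M - {#k#}"])
      (auto dest: in_diffD)
  also have "\<dots> = fps_X ^ k * part_gf (insert k S)"
    by (simp add: gf_add_const part_gf_def)
  finally have "part_gf (insert k S) = part_gf S + fps_X ^ k * part_gf (insert k S)"
    by (simp only: part_gf_def)
  then have "part_gf (insert k S) + fps_X ^ k * part_gf (insert k S) = part_gf S"
    by (metis add.assoc add_0_right bit_fps_double)
  then show ?thesis by (simp add: algebra_simps)
qed

lemma part_gf_prod:
  assumes "finite S" "0 \<notin> S"
  shows "part_gf S * (\<Prod>k\<in>S. 1 + fps_X ^ k) = 1"
  using assms
proof (induction S rule: finite_induct)
  case empty
  have "{M :: nat multiset. set_mset M \<subseteq> {} \<and> sum_mset M = n} = (if n = 0 then {{#}} else {})" for n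
    by auto
  then show ?case by (intro fps_ext) (simp add: part_gf_def gf_nth)
next
  case (insert k S)
  then have "part_gf (insert k S) * (\<Prod>k\<in>insert k S. 1 + fps_X ^ k) =
      (part_gf (insert k S) * (1 + fps_X ^ k)) * (\<Prod>k\<in>S. 1 + fps_X ^ k)" by (simp add: mult_ac)
  also have "\<dots> = 1" using insert part_gf_insert[of k S] by simp
  finally show ?case .
qed

text \<open>Up to \<open>q^n\<close> only parts at most \<open>n\<close> matter, which reduces the
  claim to a finite product.\<close>

lemma part_gf_eta:
  assumes "0 \<notin> S"
  shows "part_gf S * eta S = 1"
proof (rule fps_ext)
  fix n
  have "part_gf S $ i = part_gf (S \<inter> {1..n}) $ i" if "i \<le> n" for i
  proof -
    have "k \<le> n" if "k \<in># M" "sum_mset M = i" for M k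
      using \<open>i \<le> n\<close> that by (metis le_add1 le_trans sum_mset.remove)
    then have "{M \<in> {M. set_mset M \<subseteq> S}. sum_mset M = i} = {M \<in> {M. set_mset M \<subseteq> S \<inter> {1..n}}. sum_mset M = i}"
      using assms by (auto simp: Suc_le_eq) (metis gr0I subsetD)
    then show ?thesis by (simp add: part_gf_def gf_nth)
  qed
  then have "(part_gf S * eta S) $ n = (part_gf (S \<inter> {1..n}) * (\<Prod>k\<in>S \<inter> {1..n}. 1 + fps_X ^ k)) $ n"
    unfolding fps_mult_nth by (intro sum.cong) (simp_all add: eta_nth[where N = n])
  then show "(part_gf S * eta S) $ n = 1 $ n" using part_gf_prod[of "S \<inter> {1..n}"] assms by simp
qed

definition reg25 :: "bit fps" where
  "reg25 = Abs_fps (\<lambda>n. of_nat (num_regular_partitions 25 n))"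

text \<open>Split the Euler product by divisibility of the index by 25: \<open>reg25\<close> inverts
  one half, and the other is \<open>euler\<close> in \<open>q^25\<close>.\<close>

lemma reg25_mult_euler: "reg25 * euler = euler oo fps_X ^ 25"
proof -
  have "{M \<in> {M. set_mset M \<subseteq> {k. \<not> 25 dvd k}}. sum_mset M = n} = regular_partitions 25 n" for n
    by (auto simp: regular_partitions_def partitions_def intro!: Nat.gr0I)
  then have r: "reg25 = part_gf {k. \<not> 25 dvd k}"
    by (simp add: reg25_def part_gf_def gf_def num_regular_partitions_def)
  have "euler = eta ({k. \<not> 25 dvd k} \<union> {k. 25 dvd k})"
    by (rule arg_cong[where f = eta]) auto
  also have "\<dots> = eta {k. \<not> 25 dvd k} * eta {k. 25 dvd k}"
    by (rule eta_mult) auto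
  also have "{k :: nat. 25 dvd k} = (*) 25 ` UNIV" by (auto elim: dvdE)
  also have "eta \<dots> = euler oo fps_X ^ 25" by (rule eta_image_mult) simp
  finally have "reg25 * euler = (reg25 * eta {k. \<not> 25 dvd k}) * (euler oo fps_X ^ 25)"
    by (simp add: mult.assoc)
  then show ?thesis using part_gf_eta[of "{k. \<not> 25 dvd k}"] by (simp add: r)
qed

section \<open>Dissection modulo 5\<close>

text \<open>Homogeneity for the grading of series by exponents modulo 5; \<open>residue_part\<close>
  is the projection onto a component.\<close>

definition exps_cong :: "nat \<Rightarrow> bit fps \<Rightarrow> bool" where
  "exps_cong r f \<longleftrightarrow> (\<forall>n. f $ n \<noteq> 0 \<longrightarrow> [n = r] (mod 5))"

definition residue_part :: "nat \<Rightarrow> bit fps \<Rightarrow> bit fps" where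
  "residue_part r f = Abs_fps (\<lambda>n. if [n = r] (mod 5) then f $ n else 0)"

lemma exps_cong_mult:
  assumes "exps_cong r f" "exps_cong s g"
  shows "exps_cong (r + s) (f * g)"
  unfolding exps_cong_def
proof (intro allI impI)
  fix n assume "(f * g) $ n \<noteq> 0"
  then obtain i where "i \<in> {0..n}" "f $ i * g $ (n - i) \<noteq> 0"
    unfolding fps_mult_nth by (meson sum.not_neutral_contains_not_neutral)
  then have "[i = r] (mod 5)" "[n - i = s] (mod 5)" "n = i + (n - i)"
    using assms by (auto simp: exps_cong_def)
  then show "[n = r + s] (mod 5)" by (metis cong_add)
qed

lemma exps_cong_power2: "exps_cong r f \<Longrightarrow> exps_cong (r + r) (f\<^sup>2)"
  by (simp add: power2_eq_square exps_cong_mult)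

lemma exps_cong_q_deriv: "exps_cong r f \<Longrightarrow> exps_cong r (q_deriv f)"
  by (auto simp: exps_cong_def q_deriv_nth)

lemma exps_cong_gf: "(\<And>x. x \<in> A \<Longrightarrow> [w x = r] (mod 5)) \<Longrightarrow> exps_cong r (gf A w)"
  unfolding exps_cong_def gf_nth
proof (intro allI impI)
  fix n assume *: "\<And>x. x \<in> A \<Longrightarrow> [w x = r] (mod 5)" and "of_nat (card {x \<in> A. w x = n}) \<noteq> (0 :: bit)"
  then have "{x \<in> A. w x = n} \<noteq> {}" by (metis card.empty of_nat_0)
  then show "[n = r] (mod 5)" using * by auto
qed

lemma residue_part_add: "residue_part r (f + g) = residue_part r f + residue_part r g"
  by (rule fps_ext) (simp add: residue_part_def)

lemma residue_part_eq:
  assumes "exps_cong s f"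
  shows "residue_part r f = (if [s = r] (mod 5) then f else 0)"
proof (rule fps_ext)
  fix n
  show "residue_part r f $ n = (if [s = r] (mod 5) then f else 0) $ n"
    using assms unfolding exps_cong_def residue_part_def cong_def by (cases "f $ n = 0") auto
qed

lemma exps_cong_theta_1: "exps_cong 1 \<theta>\<^sub>1"
  unfolding theta_def
proof (rule exps_cong_gf)
  fix s :: int assume "s \<in> {s. [s = 1] (mod 5)}"
  then have "[s\<^sup>2 = 1] (mod 5)" using cong_pow[of s 1 5 2] by simp
  then have "[int (nat (s\<^sup>2)) = int 1] (mod int 5)" by simp
  then show "[nat (s\<^sup>2) = 1] (mod 5)" by (simp only: cong_int_iff)
qed

lemma exps_cong_theta_2: "exps_cong 4 \<theta>\<^sub>2"
  unfolding theta_def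
proof (rule exps_cong_gf)
  fix s :: int assume "s \<in> {s. [s = 2] (mod 5)}"
  then have "[s\<^sup>2 = 4] (mod 5)" using cong_pow[of s 2 5 2] by simp
  then have "[int (nat (s\<^sup>2)) = int 4] (mod int 5)" by simp
  then show "[nat (s\<^sup>2) = 4] (mod 5)" by (simp only: cong_int_iff)
qed

lemma exps_cong_compose: "exps_cong 0 (f oo fps_X ^ 25)"
  by (auto simp: exps_cong_def fps_compose_X_power_nth cong_0_iff elim!: dvd_trans[rotated])

lemma gf_mult_const:
  assumes "0 < m"
  shows "gf A (\<lambda>x. m * w x) = gf A w oo fps_X ^ m"
proof (rule fps_ext)
  fix n
  have "{x \<in> A. m * w x = n} = (if m dvd n then {x \<in> A. w x = n div m} else {})"
    using assms by auto
  then show "gf A (\<lambda>x. m * w x) $ n = (gf A w oo fps_X ^ m) $ n"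
    using assms by (simp add: gf_nth fps_compose_X_power_nth)
qed

lemma squares_eq: "squares = (squares oo fps_X ^ 25) + (\<theta>\<^sub>1 + \<theta>\<^sub>2)"
proof -
  have fin: "finite_fibres A (\<lambda>s :: nat. s\<^sup>2)" for A
    unfolding finite_fibres_def
  proof
    fix n
    have "{s \<in> A. s\<^sup>2 = n} \<subseteq> {..n}" by (auto simp: power2_nat_le_imp_le)
    then show "finite {s \<in> A. s\<^sup>2 = n}" by (rule finite_subset) simp
  qed
  have "squares = gf {s. 0 < s \<and> 5 dvd s} (\<lambda>s. s\<^sup>2) + gf {s :: nat. \<not> 5 dvd s} (\<lambda>s. s\<^sup>2)"
    unfolding squares_def by (subst gf_Un[symmetric]) (auto intro!: fin gf_cong Nat.gr0I)
  also have "gf {s. 0 < s \<and> 5 dvd s} (\<lambda>s :: nat. s\<^sup>2) = gf {s. 0 < s} (\<lambda>s. 25 * s\<^sup>2)"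
    by (rule gf_reindex[of "\<lambda>s. 5 * s"], rule bij_betw_byWitness[where f' = "\<lambda>s. s div 5"])
      (auto simp: power_mult_distrib)
  also have "\<dots> = squares oo fps_X ^ 25"
    by (simp add: gf_mult_const squares_def)
  finally show ?thesis by (simp only: gf_squares_coprime_5)
qed

lemma bit_fps_square_add: "(f + g :: bit fps)\<^sup>2 = f\<^sup>2 + g\<^sup>2"
  by (simp add: power2_sum bit_fps_two)

text \<open>Separates a part in \<open>q^25\<close>, of degree 0 for the grading, from
  \<open>\<theta>\<^sub>1\<close>, \<open>\<theta>\<^sub>2\<close> and their squares, of degrees 1,
  4, 2, 3. It follows from additivity of Frobenius.\<close>

lemma log_deriv_split:
  "log_deriv = (log_deriv oo fps_X ^ 25) + (\<theta>\<^sub>1 + \<theta>\<^sub>2) + (\<theta>\<^sub>1 + \<theta>\<^sub>2)\<^sup>2"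
proof -
  have "log_deriv oo fps_X ^ 25 = (squares oo fps_X ^ 25) + (squares oo fps_X ^ 25)\<^sup>2"
    by (simp add: log_deriv_eq fps_compose_add_distrib fps_compose_power)
  moreover have "log_deriv = ((squares oo fps_X ^ 25) + (\<theta>\<^sub>1 + \<theta>\<^sub>2)) + ((squares oo fps_X ^ 25) + (\<theta>\<^sub>1 + \<theta>\<^sub>2))\<^sup>2"
    using log_deriv_eq squares_eq by simp
  ultimately show ?thesis by (simp add: bit_fps_square_add add_ac)
qed

lemma pent_mod_5:
  "s mod 5 \<in> {0, 2} \<Longrightarrow> [pent s = 0] (mod 5)" "s mod 5 = 1 \<Longrightarrow> [pent s = 1] (mod 5)"
  "s mod 5 \<in> {3, 4} \<Longrightarrow> [pent s = 2] (mod 5)"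
proof -
  define t where "t = s div 5"
  have s: "s = 5 * t + s mod 5" by (simp add: t_def)
  have "even (s * (3 * s - 1))" by simp
  moreover have "0 \<le> s * (3 * s - 1)" by (simp add: zero_le_mult_iff) linarith
  ultimately have "2 * int (pent s) = s * (3 * s - 1)" by (auto simp: pent_def)
  also have "s * (3 * s - 1) = 5 * (15 * t\<^sup>2 + 6 * t * (s mod 5) - t) + (s mod 5) * (3 * (s mod 5) - 1)"
    by (subst (1 2) s) (simp add: power2_eq_square algebra_simps del: mult_div_mod_eq)
  finally have *: "2 * int (pent s) = 5 * (15 * t\<^sup>2 + 6 * t * (s mod 5) - t) + (s mod 5) * (3 * (s mod 5) - 1)" .
  define r where "r = s mod 5"
  \<comment> \<open>Multiplication by 3, the inverse of 2 modulo 5, undoes the doubling.\<close>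
  have "int (pent s) = 3 * (r * (3 * r - 1)) + 5 * (3 * (15 * t\<^sup>2 + 6 * t * r - t) - int (pent s))"
    using * by (simp add: r_def)
  then have "int (pent s) mod 5 = 3 * (r * (3 * r - 1)) mod 5" by (metis mod_mult_self2)
  then have "int (pent s) mod 5 = int k mod 5" if "3 * (r * (3 * r - 1)) mod 5 = int k" "k < 5" for k
    using that by simp
  then have "[pent s = k] (mod 5)" if "3 * (r * (3 * r - 1)) mod 5 = int k" "k < 5" for k
    using that cong_int_iff[of "pent s" k 5] by (simp add: cong_def)
  note c = this[unfolded r_def]
  show "s mod 5 \<in> {0, 2} \<Longrightarrow> [pent s = 0] (mod 5)" by (rule c) auto
  show "s mod 5 = 1 \<Longrightarrow> [pent s = 1] (mod 5)" by (rule c) auto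
  show "s mod 5 \<in> {3, 4} \<Longrightarrow> [pent s = 2] (mod 5)" by (rule c) auto
qed

text \<open>Pentagonal numbers are self-similar:
  \<open>pent (1 - 5 * t) = 1 + 25 * pent t\<close>.\<close>

lemma pent_1_mod_5: "gf {s. s mod 5 = 1} pent = fps_X * (euler oo fps_X ^ 25)"
proof -
  have "gf {s. s mod 5 = 1} pent = gf UNIV (\<lambda>t. 1 + 25 * pent t)"
  proof (rule gf_reindex)
    have div: "1 + 5 * (s div 5) = s" if "s mod 5 = 1" for s :: int
      using mult_div_mod_eq[of 5 s] that by linarith
    show "bij_betw (\<lambda>t. 1 - 5 * t) UNIV {s :: int. s mod 5 = 1}"
      by (rule bij_betw_byWitness[where f' = "\<lambda>s. - (s div 5)"])
        (auto simp: div mod_diff_eq[symmetric] zdiv_zminus1_eq_if)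
    fix t :: int
    have e: "even (t * (3 * t - 1))" by simp
    have "0 \<le> t * (3 * t - 1)" by (simp add: zero_le_mult_iff) linarith
    moreover have "(1 - 5 * t) * (3 * (1 - 5 * t) - 1) div 2 = 1 + 25 * (t * (3 * t - 1) div 2)"
    proof -
      obtain y where y: "t * (3 * t - 1) = 2 * y" using e by (elim evenE)
      have "(1 - 5 * t) * (3 * (1 - 5 * t) - 1) = 2 + 25 * (t * (3 * t - 1))" by (simp add: algebra_simps)
      also have "\<dots> = 2 * (1 + 25 * y)" unfolding y by simp
      finally show ?thesis unfolding y by simp
    qed
    ultimately show "pent (1 - 5 * t) = 1 + 25 * pent t"
      by (simp add: pent_def nat_add_distrib nat_mult_distrib)
  qed
  also have "\<dots> = fps_X * (gf UNIV pent oo fps_X ^ 25)"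
    using gf_add_const[of UNIV 1 "\<lambda>t. 25 * pent t"] by (simp add: gf_mult_const)
  finally show ?thesis by (simp add: pentagonal)
qed

lemma bit_fps_double_left: "f + (f + g) = (g :: bit fps)"
  using bit_fps_double[of f] by (simp flip: add.assoc)

lemma bit_fps_eq_iff: "f = (g :: bit fps) \<longleftrightarrow> f + g = 0"
  by (metis bit_fps_minus eq_iff_diff_eq_0)

lemmas char_2_simps = algebra_simps power2_eq_square power3_eq_cube bit_fps_double bit_fps_double_left

text \<open>The components of \<open>euler\<close> in the exponent classes 0, 1, 2. The explicit
  middle one has a computable derivative, which supplies the extra relation in class 1.\<close>

locale euler_dissection =
  fixes a m b :: "bit fps"
  assumes euler_split: "euler = a + m + b"
    and a: "exps_cong 0 a" and b: "exps_cong 2 b" 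
    and m: "m = fps_X * (euler oo fps_X ^ 25)"
begin

lemma exps_cong_m: "exps_cong 1 m"
proof -
  have "exps_cong 1 fps_X" by (auto simp: exps_cong_def fps_X_def)
  from exps_cong_mult[OF this exps_cong_compose] show ?thesis by (simp add: m)
qed

text \<open>Since 25 is odd, \<open>q_deriv\<close> commutes with substituting \<open>q^25\<close>;
  the first summand comes from the factor \<open>fps_X\<close>.\<close>

lemma q_deriv_m: "q_deriv m = m + m * (log_deriv oo fps_X ^ 25)"
proof -
  have "q_deriv (euler oo fps_X ^ 25) = q_deriv euler oo fps_X ^ 25"
  proof (rule fps_ext)
    fix n
    have "of_nat n = (of_nat (n div 25) :: bit)" if "25 dvd n"
      using that by (elim dvdE) (simp add: of_nat_bit)
    then show "q_deriv (euler oo fps_X ^ 25) $ n = (q_deriv euler oo fps_X ^ 25) $ n"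
      by (simp add: q_deriv_nth fps_compose_X_power_nth)
  qed
  also have "\<dots> = (euler oo fps_X ^ 25) * (log_deriv oo fps_X ^ 25)"
    by (simp add: q_deriv_euler fps_compose_mult_distrib)
  finally show ?thesis
    by (simp add: m q_deriv_mult) (simp add: q_deriv_def algebra_simps)
qed

text \<open>These are the components of \<open>q_deriv euler = euler * log_deriv\<close> in classes
  1, 3 and 4. In class 1 the term \<open>m * ?P\<close> cancels against \<open>q_deriv_m\<close>; in
  classes 3 and 4 the left side vanishes.\<close>

lemma dissected:
  shows "m + a * \<theta>\<^sub>1 + b * \<theta>\<^sub>2 = 0" and "a * \<theta>\<^sub>2\<^sup>2 + m * \<theta>\<^sub>1\<^sup>2 + b * \<theta>\<^sub>1 = 0"
    and "a * \<theta>\<^sub>2 + m * \<theta>\<^sub>2\<^sup>2 + b * \<theta>\<^sub>1\<^sup>2 = 0"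
proof -
  let ?P = "log_deriv oo fps_X ^ 25"
  note h = exps_cong_compose[of log_deriv] exps_cong_theta_1 exps_cong_theta_2
    exps_cong_power2[OF exps_cong_theta_1] exps_cong_power2[OF exps_cong_theta_2]
  note prods = h[THEN exps_cong_mult[OF a]] h[THEN exps_cong_mult[OF exps_cong_m]] h[THEN exps_cong_mult[OF b]]
    exps_cong_q_deriv[OF a] exps_cong_q_deriv[OF exps_cong_m] exps_cong_q_deriv[OF b]
  have "q_deriv (a + m + b) = (a + m + b) * (?P + (\<theta>\<^sub>1 + \<theta>\<^sub>2) + (\<theta>\<^sub>1 + \<theta>\<^sub>2)\<^sup>2)"
    using q_deriv_euler unfolding euler_split by (simp only: log_deriv_split[symmetric])
  then have "q_deriv a + q_deriv m + q_deriv b =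
      a * ?P + a * \<theta>\<^sub>1 + a * \<theta>\<^sub>2 + a * \<theta>\<^sub>1\<^sup>2 + a * \<theta>\<^sub>2\<^sup>2 +
      (m * ?P + m * \<theta>\<^sub>1 + m * \<theta>\<^sub>2 + m * \<theta>\<^sub>1\<^sup>2 + m * \<theta>\<^sub>2\<^sup>2) +
      (b * ?P + b * \<theta>\<^sub>1 + b * \<theta>\<^sub>2 + b * \<theta>\<^sub>1\<^sup>2 + b * \<theta>\<^sub>2\<^sup>2)"
    by (simp only: q_deriv_add bit_fps_square_add ring_distribs add_ac)
  note eqs = arg_cong[where f = "residue_part r" for r, OF this, unfolded residue_part_add prods[THEN residue_part_eq]]
  have "q_deriv m = a * \<theta>\<^sub>1 + m * ?P + b * \<theta>\<^sub>2"
    using eqs[of 1] by (simp add: cong_def)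
  then have "(m + m * ?P) + (a * \<theta>\<^sub>1 + m * ?P + b * \<theta>\<^sub>2) = 0"
    by (simp only: q_deriv_m bit_fps_double)
  then show "m + a * \<theta>\<^sub>1 + b * \<theta>\<^sub>2 = 0"
    by (simp add: char_2_simps)
  show "a * \<theta>\<^sub>2\<^sup>2 + m * \<theta>\<^sub>1\<^sup>2 + b * \<theta>\<^sub>1 = 0"
    using eqs[of 3] by (simp add: cong_def add_ac)
  show "a * \<theta>\<^sub>2 + m * \<theta>\<^sub>2\<^sup>2 + b * \<theta>\<^sub>1\<^sup>2 = 0"
    using eqs[of 4] by (simp add: cong_def add_ac)
qed

end

lemma euler_dissection:
  "euler_dissection (gf {s. s mod 5 \<in> {0, 2}} pent) (gf {s. s mod 5 = 1} pent) (gf {s. s mod 5 \<in> {3, 4}} pent)"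
proof
  let ?A = "{s :: int. s mod 5 \<in> {0, 2}}" and ?M = "{s :: int. s mod 5 = 1}" and ?B = "{s :: int. s mod 5 \<in> {3, 4}}"
  have "UNIV = (?A \<union> ?M) \<union> ?B" 
  proof -
    have "s mod 5 = 0 \<or> s mod 5 = 1 \<or> s mod 5 = 2 \<or> s mod 5 = 3 \<or> s mod 5 = 4" for s :: int
      using pos_mod_sign[of 5 s] pos_mod_bound[of 5 s] by linarith
    then show ?thesis by blast
  qed
  then have "euler = gf ((?A \<union> ?M) \<union> ?B) pent" by (simp add: pentagonal)
  also have "\<dots> = gf ?A pent + gf ?M pent + gf ?B pent"
    by (subst gf_Un; (subst gf_Un)?; auto intro!: finite_fibres_pent)
  finally show "euler = gf ?A pent + gf ?M pent + gf ?B pent" .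
qed (auto intro!: exps_cong_gf pent_mod_5 simp: pent_1_mod_5)

section \<open>Algebra in characteristic 2\<close>

lemma theta_1_nth_1: "\<theta>\<^sub>1 $ 1 = 1"
proof -
  have "{s \<in> {s. [s = 1] (mod 5)}. nat (s\<^sup>2) = 1} = {1 :: int}"
    by (auto simp: power2_eq_1_iff nat_eq_iff cong_def)
  then show ?thesis by (simp add: theta_def gf_nth)
qed

lemma theta_2_nth_4: "\<theta>\<^sub>2 $ 4 = 1"
proof -
  have "s = 2" if "s\<^sup>2 = 4" "s mod 5 = 2" for s :: int
    using that power2_eq_iff[of s 2] by auto
  then have "{s \<in> {s. [s = 2] (mod 5)}. nat (s\<^sup>2) = 4} = {2 :: int}"
    by (auto simp: nat_eq_iff cong_def)
  then show ?thesis by (simp add: theta_def gf_nth)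
qed

lemma theta_2_nth_small: "n < 4 \<Longrightarrow> \<theta>\<^sub>2 $ n = 0"
  using exps_cong_theta_2 by (auto simp: exps_cong_def cong_def)

context euler_dissection
begin

lemma euler_nth_0: "euler $ 0 = 1"
  by (simp add: eta_def)

text \<open>\<open>m\<close> is \<open>q\<close> times a unit and \<open>b\<close> has no constant
  term. Hence the quotient \<open>rho\<close> is a power series.\<close>

lemma m_dvd_b: "m dvd b"
proof -
  have "b $ 0 = 0" using b by (auto simp: exps_cong_def cong_def)
  then have "b = fps_X * fps_shift 1 b" by (simp add: fps_eq_iff)
  moreover have "(euler oo fps_X ^ 25) * inverse (euler oo fps_X ^ 25) = 1"
    by (rule inverse_mult_eq_1') (simp add: fps_compose_X_power_nth euler_nth_0)
  ultimately have "b = m * (fps_shift 1 b * inverse (euler oo fps_X ^ 25))"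
    unfolding m by (metis (no_types, lifting) mult.assoc mult.commute mult.right_neutral)
  then show ?thesis by (rule dvdI)
qed

lemma m_nonzero: "m \<noteq> 0"
proof -
  have "m $ 1 = 1" by (simp add: m fps_compose_X_power_nth euler_nth_0)
  then show ?thesis by auto
qed

text \<open>The factors cancelled in \<open>rho_eqs\<close>; each has a visible nonzero low
  coefficient.\<close>

lemma theta_nonzero: "\<theta>\<^sub>1 \<noteq> 0" "\<theta>\<^sub>2 \<noteq> 0" "\<theta>\<^sub>1\<^sup>2 + \<theta>\<^sub>2 ^ 3 \<noteq> 0"
proof -
  show "\<theta>\<^sub>1 \<noteq> 0" "\<theta>\<^sub>2 \<noteq> 0" using theta_1_nth_1 theta_2_nth_4 by auto
  have "(\<theta>\<^sub>2 ^ 3) $ 2 = 0"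
    by (auto simp: power3_eq_cube fps_mult_nth theta_2_nth_small intro!: sum.neutral)
  moreover have "(\<theta>\<^sub>1\<^sup>2) $ 2 = 1" using theta_1_nth_1 by (simp add: bit_fps_square_nth)
  ultimately have "(\<theta>\<^sub>1\<^sup>2 + \<theta>\<^sub>2 ^ 3) $ 2 = 1" by simp
  then show "\<theta>\<^sub>1\<^sup>2 + \<theta>\<^sub>2 ^ 3 \<noteq> 0" by (metis fps_zero_nth zero_neq_one)
qed

end

text \<open>\<open>rho = b / m\<close> is the single parameter in which the theta and Lambert
  series, and later \<open>h\<close>, become rational.\<close>

locale euler_dissection_rho = euler_dissection +
  fixes rho :: "bit fps"
  assumes b_eq: "b = m * rho"
begin

text \<open>The relations in \<open>dissected\<close> are linear in \<open>a\<close>,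
  \<open>m\<close>, \<open>b\<close>; eliminating \<open>a\<close> leaves equations for the theta
  series over \<open>rho\<close>. They yield \<open>\<theta>\<^sub>1 = rho / (1 + rho^5)\<close> and
  \<open>\<theta>\<^sub>2 = rho^4 / (1 + rho^5)\<close>.\<close>

lemma rho_eqs:
  shows "\<theta>\<^sub>1 = rho + rho\<^sup>2 * \<theta>\<^sub>2" and "rho * a = m" and "(1 + rho ^ 5) * \<theta>\<^sub>2 = rho ^ 4"
proof -
  note E = dissected[unfolded b_eq]
  let ?A = "\<theta>\<^sub>1\<^sup>2 + \<theta>\<^sub>2 ^ 3" and ?B = "\<theta>\<^sub>1 ^ 3 + \<theta>\<^sub>2\<^sup>2" and ?C = "\<theta>\<^sub>2 + \<theta>\<^sub>1 * \<theta>\<^sub>2\<^sup>2"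
  \<comment> \<open>The multipliers are chosen so that both terms
    \<open>a * \<theta>\<^sub>1 * \<theta>\<^sub>2\<^sup>2\<close> cancel.\<close>
  have "m * (rho * ?A + ?B) = \<theta>\<^sub>1 * (a * \<theta>\<^sub>2\<^sup>2 + m * \<theta>\<^sub>1\<^sup>2 + m * rho * \<theta>\<^sub>1) + \<theta>\<^sub>2\<^sup>2 * (m + a * \<theta>\<^sub>1 + m * rho * \<theta>\<^sub>2)"
    by (simp add: char_2_simps)
  then have AB: "rho * ?A + ?B = 0" using E m_nonzero by simp
  have "m * (rho * ?B + ?C) = \<theta>\<^sub>1 * (a * \<theta>\<^sub>2 + m * \<theta>\<^sub>2\<^sup>2 + m * rho * \<theta>\<^sub>1\<^sup>2) + \<theta>\<^sub>2 * (m + a * \<theta>\<^sub>1 + m * rho * \<theta>\<^sub>2)"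
    by (simp add: char_2_simps)
  then have BC: "rho * ?B + ?C = 0" using E m_nonzero by simp
  \<comment> \<open>Rests on \<open>?B + \<theta>\<^sub>2 * ?C = \<theta>\<^sub>1 * ?A\<close>,
    after which the nonzero factor \<open>?A\<close> can be cancelled.\<close>
  have "?A * (rho + rho\<^sup>2 * \<theta>\<^sub>2 + \<theta>\<^sub>1) = (rho * ?A + ?B) + rho * \<theta>\<^sub>2 * (rho * ?A + ?B) + \<theta>\<^sub>2 * (rho * ?B + ?C)"
    by (simp add: char_2_simps)
  then have "rho + rho\<^sup>2 * \<theta>\<^sub>2 + \<theta>\<^sub>1 = 0" using AB BC theta_nonzero(3) by simp
  then show t1: "\<theta>\<^sub>1 = rho + rho\<^sup>2 * \<theta>\<^sub>2" using bit_fps_eq_iff by metis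
  have "\<theta>\<^sub>1 * (rho * a + m) = rho * (m + a * \<theta>\<^sub>1 + m * rho * \<theta>\<^sub>2) + m * (rho + rho\<^sup>2 * \<theta>\<^sub>2 + \<theta>\<^sub>1)"
    by (simp add: char_2_simps)
  then have "rho * a + m = 0" using E \<open>rho + rho\<^sup>2 * \<theta>\<^sub>2 + \<theta>\<^sub>1 = 0\<close> theta_nonzero(1) by simp
  then show ra: "rho * a = m" using bit_fps_eq_iff by metis
  have "rho * (a * \<theta>\<^sub>2\<^sup>2 + m * \<theta>\<^sub>1\<^sup>2 + m * rho * \<theta>\<^sub>1) = (rho * a) * \<theta>\<^sub>2\<^sup>2 + m * (rho * \<theta>\<^sub>1\<^sup>2 + rho\<^sup>2 * \<theta>\<^sub>1)"
    by (simp add: char_2_simps)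
  also have "\<dots> = m * (\<theta>\<^sub>2\<^sup>2 + rho * \<theta>\<^sub>1\<^sup>2 + rho\<^sup>2 * \<theta>\<^sub>1)"
    unfolding ra by (simp add: algebra_simps)
  also have "\<theta>\<^sub>2\<^sup>2 + rho * \<theta>\<^sub>1\<^sup>2 + rho\<^sup>2 * \<theta>\<^sub>1 = \<theta>\<^sub>2 * ((1 + rho ^ 5) * \<theta>\<^sub>2 + rho ^ 4)"
    unfolding t1 by (simp add: char_2_simps eval_nat_numeral)
  finally have "(1 + rho ^ 5) * \<theta>\<^sub>2 + rho ^ 4 = 0" using E(2) m_nonzero theta_nonzero(2) by simp
  then show "(1 + rho ^ 5) * \<theta>\<^sub>2 = rho ^ 4" using bit_fps_eq_iff by metis
qed

lemma rho_theta_1: "(1 + rho ^ 5) * \<theta>\<^sub>1 = rho"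
proof -
  have "(1 + rho ^ 5) * \<theta>\<^sub>1 = (1 + rho ^ 5) * rho + rho\<^sup>2 * ((1 + rho ^ 5) * \<theta>\<^sub>2)"
    by (subst rho_eqs(1)) (simp add: algebra_simps)
  also have "\<dots> = rho" unfolding rho_eqs(3) by (simp add: char_2_simps eval_nat_numeral)
  finally show ?thesis .
qed

text \<open>\<open>lambert_12\<close> and \<open>lambert_13\<close> form a linear system with
  determinant \<open>1 + \<theta>\<^sub>1 * \<theta>\<^sub>2\<close>, nonzero because its constant
  term is 1; the stated values solve it.\<close>

lemma rho_lambert:
  shows "(1 + rho ^ 5) * lambert 1 2 = rho\<^sup>2" and "(1 + rho ^ 5) * lambert 1 3 = rho ^ 3"
proof -
  let ?k = "lambert 1 2" and ?l = "lambert 1 3" and ?u = "1 + rho ^ 5"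
  have t1: "rho + rho\<^sup>2 * \<theta>\<^sub>2 + \<theta>\<^sub>1 = 0" using rho_eqs(1) bit_fps_eq_iff by metis
  have k: "?k + ?l * \<theta>\<^sub>2 = \<theta>\<^sub>1\<^sup>2"
    using lambert_12 by (metis add.assoc add.commute add_0_right bit_fps_double)
  \<comment> \<open>The deviations from the claimed values are shown to solve the homogeneous
    system, through \<open>d2\<close> and \<open>d3\<close>.\<close>
  have "(?u * ?k + rho\<^sup>2) + \<theta>\<^sub>2 * (?u * ?l + rho ^ 3) = ?u * (?k + ?l * \<theta>\<^sub>2) + rho\<^sup>2 + rho ^ 3 * \<theta>\<^sub>2"
    by (simp add: algebra_simps)
  also have "?u * (?k + ?l * \<theta>\<^sub>2) = (?u * \<theta>\<^sub>1) * \<theta>\<^sub>1" by (simp add: k power2_eq_square)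
  also have "\<dots> = rho * \<theta>\<^sub>1" by (simp only: rho_theta_1)
  also have "rho * \<theta>\<^sub>1 + rho\<^sup>2 + rho ^ 3 * \<theta>\<^sub>2 = rho * (rho + rho\<^sup>2 * \<theta>\<^sub>2 + \<theta>\<^sub>1)"
    by (simp add: char_2_simps)
  finally have d2: "?u * ?k + rho\<^sup>2 = \<theta>\<^sub>2 * (?u * ?l + rho ^ 3)"
    unfolding t1 using bit_fps_eq_iff by (metis mult_zero_right)
  have "(?u * ?l + rho ^ 3) + \<theta>\<^sub>1 * (?u * ?k + rho\<^sup>2) = ?u * (?l + ?k * \<theta>\<^sub>1) + rho ^ 3 + rho\<^sup>2 * \<theta>\<^sub>1"
    by (simp add: algebra_simps)
  also have "?u * (?l + ?k * \<theta>\<^sub>1) = (?u * \<theta>\<^sub>2) * \<theta>\<^sub>2" by (simp add: lambert_13 power2_eq_square)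
  also have "\<dots> = rho ^ 4 * \<theta>\<^sub>2" by (simp only: rho_eqs(3))
  also have "rho ^ 4 * \<theta>\<^sub>2 + rho ^ 3 + rho\<^sup>2 * \<theta>\<^sub>1 = rho\<^sup>2 * (rho + rho\<^sup>2 * \<theta>\<^sub>2 + \<theta>\<^sub>1)"
    by (simp add: char_2_simps eval_nat_numeral)
  finally have d3: "?u * ?l + rho ^ 3 = \<theta>\<^sub>1 * (?u * ?k + rho\<^sup>2)"
    unfolding t1 using bit_fps_eq_iff by (metis mult_zero_right)
  have "(1 + \<theta>\<^sub>1 * \<theta>\<^sub>2) * (?u * ?l + rho ^ 3) = (?u * ?l + rho ^ 3) + \<theta>\<^sub>1 * (\<theta>\<^sub>2 * (?u * ?l + rho ^ 3))"
    by (simp add: algebra_simps)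
  also have "\<dots> = 0" unfolding d2[symmetric] d3[symmetric] by (rule bit_fps_double)
  moreover have "1 + \<theta>\<^sub>1 * \<theta>\<^sub>2 \<noteq> 0"
  proof -
    have "(1 + \<theta>\<^sub>1 * \<theta>\<^sub>2) $ 0 = 1" by (simp add: theta_2_nth_small)
    then show ?thesis by (metis fps_zero_nth zero_neq_one)
  qed
  ultimately have l0: "?u * ?l + rho ^ 3 = 0" by simp
  then show "?u * ?l = rho ^ 3" using bit_fps_eq_iff by metis
  show "?u * ?k = rho\<^sup>2" using d2 l0 bit_fps_eq_iff by (metis mult_zero_right)
qed

text \<open>Here \<open>h = rho / (1 + rho + rho^2)\<close>, and the logarithmic derivatives of
  \<open>m\<close> and \<open>euler\<close> give
  \<open>h + q_deriv h = h * (?T + ?T\<^sup>2)\<close>. Clearing denominators leaves a polynomial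
  identity in \<open>rho\<close>.\<close>

lemma square_identity:
  assumes h: "h * euler = m"
  shows "(\<theta>\<^sub>1 + \<theta>\<^sub>2 + lambert 1 2 + lambert 1 3)\<^sup>2 = h + q_deriv h"
proof -
  let ?T = "\<theta>\<^sub>1 + \<theta>\<^sub>2" and ?u = "1 + rho ^ 5" and ?P = "log_deriv oo fps_X ^ 25"
  let ?J = "\<theta>\<^sub>1 + \<theta>\<^sub>2 + lambert 1 2 + lambert 1 3"
  have "rho * euler = m * (1 + rho + rho\<^sup>2)"
    unfolding euler_split by (simp add: distrib_left rho_eqs(2) b_eq) (simp add: algebra_simps power2_eq_square)
  then have "m * (h * (1 + rho + rho\<^sup>2)) = rho * (h * euler)"
    by (simp add: mult_ac)
  then have hr: "h * (1 + rho + rho\<^sup>2) = rho" using h m_nonzero by simp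
  have "q_deriv h * euler + h * q_deriv euler = q_deriv m"
    unfolding h[symmetric] by (simp add: q_deriv_mult)
  then have "q_deriv h * euler + (h * euler) * log_deriv = m + m * ?P"
    by (simp add: q_deriv_m q_deriv_euler mult.assoc)
  then have "q_deriv h * euler + (h * euler) * log_deriv = h * euler + (h * euler) * ?P"
    by (simp only: h)
  then have "(q_deriv h * euler + (h * euler) * log_deriv) + (h * euler + (h * euler) * ?P) = 0"
    by (simp only: bit_fps_double)
  moreover have "(q_deriv h * euler + (h * euler) * log_deriv) + (h * euler + (h * euler) * ?P) =
      euler * (h + q_deriv h + h * (log_deriv + ?P))"
    by (simp add: algebra_simps)
  moreover have "log_deriv + ?P = ?T + ?T\<^sup>2"
  proof -
    have "log_deriv + ?P = (?P + ?T + ?T\<^sup>2) + ?P" by (simp only: log_deriv_split[symmetric])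
    then show ?thesis by (simp only: add_ac bit_fps_double bit_fps_double_left)
  qed
  moreover have "euler \<noteq> 0" using euler_nth_0 by (metis fps_zero_nth zero_neq_one)
  ultimately have "h + q_deriv h + h * (?T + ?T\<^sup>2) = 0" by simp
  then have hd: "h + q_deriv h = h * (?T + ?T\<^sup>2)" using bit_fps_eq_iff by metis
  have uJ: "?u * ?J = rho + rho ^ 4 + rho\<^sup>2 + rho ^ 3"
    by (simp only: distrib_left rho_theta_1 rho_eqs(3) rho_lambert)
  have uT: "?u * ?T = rho + rho ^ 4"
    by (simp only: distrib_left rho_theta_1 rho_eqs(3))
  have "?u\<^sup>2 * (1 + rho + rho\<^sup>2) * ?J\<^sup>2 = (?u * ?J)\<^sup>2 * (1 + rho + rho\<^sup>2)"
    by (simp only: power_mult_distrib mult_ac)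
  \<comment> \<open>In characteristic 2 both sides factor as
    \<open>rho^2 (1 + rho)^6 (1 + rho + rho^2)\<close>.\<close>
  also have "\<dots> = rho * ((rho + rho ^ 4) * (?u + (rho + rho ^ 4)))"
    unfolding uJ by (simp add: char_2_simps eval_nat_numeral)
  also have "\<dots> = (h * (1 + rho + rho\<^sup>2)) * ((?u * ?T) * (?u + ?u * ?T))"
    unfolding uT hr ..
  also have "\<dots> = ?u\<^sup>2 * (1 + rho + rho\<^sup>2) * (h * (?T + ?T\<^sup>2))"
  proof -
    have "(h * g) * ((u * t) * (u + u * t)) = u\<^sup>2 * g * (h * (t + t\<^sup>2))" for g u t :: "bit fps"
      by (simp add: power2_eq_square algebra_simps)
    then show ?thesis by this
  qed
  finally have "?u\<^sup>2 * (1 + rho + rho\<^sup>2) * ?J\<^sup>2 = ?u\<^sup>2 * (1 + rho + rho\<^sup>2) * (h * (?T + ?T\<^sup>2))" .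
  moreover have "?u \<noteq> 0"
  proof
    assume u: "?u = 0"
    then have "rho = 0" using rho_theta_1 by simp
    then show False using u by simp
  qed
  moreover have "1 + rho + rho\<^sup>2 \<noteq> 0"
  proof
    assume z: "1 + rho + rho\<^sup>2 = 0"
    then have "rho = 0" using hr by simp
    then show False using z by simp
  qed
  ultimately show ?thesis by (simp add: hd)
qed

end

text \<open>Compare coefficients of \<open>q^(2 n)\<close> in \<open>square_identity\<close> for
  \<open>h = fps_X * reg25\<close>: Frobenius halves the index on the left, and
  \<open>q_deriv\<close> vanishes at even exponents.\<close>

lemma reg25_odd:
  assumes "0 < n"
  shows "reg25 $ (2 * n - 1) = (\<theta>\<^sub>1 + \<theta>\<^sub>2 + lambert 1 2 + lambert 1 3) $ n"
proof -
  interpret euler_dissection "gf {s. s mod 5 \<in> {0, 2}} pent" "gf {s. s mod 5 = 1} pent" "gf {s. s mod 5 \<in> {3, 4}} pent"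
    by (rule euler_dissection)
  from m_dvd_b obtain rho where "gf {s. s mod 5 \<in> {3, 4}} pent = gf {s. s mod 5 = 1} pent * rho" by (rule dvdE)
  then interpret euler_dissection_rho "gf {s. s mod 5 \<in> {0, 2}} pent" "gf {s. s mod 5 = 1} pent" "gf {s. s mod 5 \<in> {3, 4}} pent" rho
    by unfold_locales
  let ?h = "fps_X * reg25" and ?J = "\<theta>\<^sub>1 + \<theta>\<^sub>2 + lambert 1 2 + lambert 1 3"
  have "?J\<^sup>2 = ?h + q_deriv ?h"
    by (rule square_identity) (simp add: reg25_mult_euler mult.assoc pent_1_mod_5)
  then have "?J\<^sup>2 $ (2 * n) = ?h $ (2 * n) + q_deriv ?h $ (2 * n)" by simp
  then show ?thesis using assms by (simp add: q_deriv_nth bit_fps_square_nth of_nat_bit)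
qed

section \<open>The Hecke property\<close>

text \<open>1 and 4 are the nonzero squares modulo 5; multiplying by one of them preserves the
  squares and the nonsquares.\<close>

lemma mult_mod_5_iff:
  fixes q x :: nat
  assumes "q mod 5 \<in> {1, 4}"
  shows "(q * x) mod 5 \<in> {1, 4} \<longleftrightarrow> x mod 5 \<in> {1, 4}"
    and "(q * x) mod 5 \<in> {2, 3} \<longleftrightarrow> x mod 5 \<in> {2, 3}"
proof -
  have "(q * x) mod 5 = (q mod 5) * (x mod 5) mod 5" by (simp add: mod_mult_eq)
  moreover have "x mod 5 < 5" by simp
  then have "x mod 5 \<in> {0, 1, 2, 3, 4}" by auto
  ultimately show "(q * x) mod 5 \<in> {1, 4} \<longleftrightarrow> x mod 5 \<in> {1, 4}"
    "(q * x) mod 5 \<in> {2, 3} \<longleftrightarrow> x mod 5 \<in> {2, 3}"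
    using assms by (elim insertE emptyE; simp)+
qed

lemma power_mod_5:
  fixes q :: nat
  assumes "q mod 5 \<in> {1, 4}"
  shows "q ^ v mod 5 \<in> {1, 4}"
  using assms by (induction v) (simp_all only: power_Suc mult_mod_5_iff, simp)

definition split_pairs :: "nat \<Rightarrow> (nat \<times> nat) set" where
  "split_pairs n = {(d, e). d mod 5 \<in> {1, 4} \<and> e mod 5 \<in> {2, 3} \<and> d * e = n}"

lemma finite_split_pairs: "0 < n \<Longrightarrow> finite (split_pairs n)"
  by (rule finite_subset[of _ "{..n} \<times> {..n}"]) (auto simp: split_pairs_def)

text \<open>Pairs with exactly one entry divisible by \<open>p\<close> are matched by moving the
  full power of \<open>p\<close> to the other entry, so they are even in number. Dividing both
  entries by \<open>p\<close> in the remaining pairs gives those for \<open>k div p\<close>.\<close>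

lemma card_split_pairs_mult_prime:
  assumes "prime p" "p mod 5 \<in> {1, 4}" "0 < k"
  shows "even (card (split_pairs (p * k))) \<longleftrightarrow> even (if p dvd k then card (split_pairs (k div p)) else 0)"
proof -
  let ?S = "split_pairs (p * k)"
  define A where "A = {(d, e) \<in> ?S. p dvd d \<and> \<not> p dvd e}"
  define B where "B = {(d, e) \<in> ?S. \<not> p dvd d \<and> p dvd e}"
  define C where "C = {(d, e) \<in> ?S. p dvd d \<and> p dvd e}"
  have p0: "0 < p" "\<not> is_unit p" using assms(1) by (auto simp: prime_gt_0_nat)
  have fin: "finite ?S" using assms p0 by (intro finite_split_pairs) simp
  have "?S = A \<union> B \<union> C"
  proof -
    have "p dvd d \<or> p dvd e" if "d * e = p * k" for d e
      using that assms(1) by (metis dvd_triv_left prime_dvd_mult_iff)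
    then show ?thesis by (auto simp: A_def B_def C_def split_pairs_def)
  qed
  moreover have "finite A" "finite B" "finite C" using fin by (auto simp: A_def B_def C_def intro: finite_subset)
  moreover have "A \<inter> B = {}" "(A \<union> B) \<inter> C = {}" by (auto simp: A_def B_def C_def)
  ultimately have card: "card ?S = card A + card B + card C" by (simp add: card_Un_disjoint)
  \<comment> \<open>If \<open>p\<close> divides only one entry of a pair, that entry contains all of
    \<open>q\<close>.\<close>
  define q where "q = p ^ multiplicity p (p * k)"
  have q: "q mod 5 \<in> {1, 4}" unfolding q_def by (rule power_mod_5[OF assms(2)])
  have q0: "0 < q" using p0 by (simp add: q_def)
  have qdvd: "q dvd p * k" by (simp add: q_def multiplicity_dvd)
  have npq: "\<not> p * q dvd p * k"
    using power_dvd_iff_le_multiplicity[of "p * k" p "Suc (multiplicity p (p * k))"] assms p0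
    by (simp add: q_def)
  have pq: "p dvd q"
  proof -
    have "multiplicity p (p * k) \<noteq> 0" using assms p0 by (simp add: multiplicity_eq_zero_iff)
    then show ?thesis by (simp add: q_def)
  qed
  have cop: "coprime q e" if "\<not> p dvd e" for e
    using that assms(1) by (simp add: q_def prime_imp_coprime)
  have "bij_betw (\<lambda>(d, e). (d div q, q * e)) A B"
  proof (rule bij_betw_byWitness[where f' = "\<lambda>(d, e). (q * d, e div q)"])
    \<comment> \<open>Stated for arbitrary \<open>d\<close>, \<open>e\<close> so that it also serves
      \<open>B\<close> with the entries exchanged.\<close>
    have A: "\<exists>d'. d = q * d' \<and> \<not> p dvd d'" if "d * e = p * k" "\<not> p dvd e" for d e
    proof -
      have "q dvd d" using qdvd that cop[of e] by (metis coprime_dvd_mult_left_iff)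
      then obtain d' where d': "d = q * d'" ..
      have "\<not> p dvd d'"
      proof
        assume "p dvd d'"
        then have "p * q dvd d * e" unfolding d' by (auto elim!: dvdE)
        then show False using npq that by simp
      qed
      then show ?thesis using d' by blast
    qed
    show "\<forall>z\<in>A. (case case z of (d, e) \<Rightarrow> (d div q, q * e) of (d, e) \<Rightarrow> (q * d, e div q)) = z"
    proof
      fix z assume z: "z \<in> A"
      obtain d e where [simp]: "z = (d, e)" by fastforce
      from z have "d * e = p * k" "\<not> p dvd e" by (auto simp: A_def split_pairs_def)
      from A[OF this] q0 show "(case case z of (d, e) \<Rightarrow> (d div q, q * e) of (d, e) \<Rightarrow> (q * d, e div q)) = z" by auto
    qed
    show "\<forall>z\<in>B. (case case z of (d, e) \<Rightarrow> (q * d, e div q) of (d, e) \<Rightarrow> (d div q, q * e)) = z"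
    proof
      fix z assume z: "z \<in> B"
      obtain d e where [simp]: "z = (d, e)" by fastforce
      from z have "e * d = p * k" "\<not> p dvd d" by (auto simp: B_def split_pairs_def mult.commute)
      from A[OF this] q0 show "(case case z of (d, e) \<Rightarrow> (q * d, e div q) of (d, e) \<Rightarrow> (d div q, q * e)) = z" by auto
    qed
    show "(\<lambda>(d, e). (d div q, q * e)) ` A \<subseteq> B"
    proof (clarify)
      fix d e assume "(d, e) \<in> A"
      then have h: "d mod 5 \<in> {1, 4}" "e mod 5 \<in> {2, 3}" "d * e = p * k" "\<not> p dvd e"
        by (auto simp: A_def split_pairs_def)
      obtain d' where d': "d = q * d'" "\<not> p dvd d'" using A[OF h(3,4)] by blast
      then show "(d div q, q * e) \<in> B"
        using h q0 pq mult_mod_5_iff[OF q] by (auto simp: B_def split_pairs_def mult_ac simp del: insert_iff)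
    qed
    show "(\<lambda>(d, e). (q * d, e div q)) ` B \<subseteq> A"
    proof (clarify)
      fix d e assume "(d, e) \<in> B"
      then have h: "d mod 5 \<in> {1, 4}" "e mod 5 \<in> {2, 3}" "e * d = p * k" "\<not> p dvd d"
        by (auto simp: B_def split_pairs_def mult.commute)
      obtain e' where e': "e = q * e'" "\<not> p dvd e'" using A[OF h(3,4)] by blast
      then show "(q * d, e div q) \<in> A"
        using h q0 pq mult_mod_5_iff[OF q] by (auto simp: A_def split_pairs_def mult_ac simp del: insert_iff)
    qed
  qed
  then have AB: "card A = card B" by (rule bij_betw_same_card)
  have C: "card C = (if p dvd k then card (split_pairs (k div p)) else 0)"
  proof (cases "p dvd k")
    case True
    then obtain j where j: "k = p * j" ..
    have "bij_betw (\<lambda>(d, e). (p * d, p * e)) (split_pairs j) C"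
    proof (rule bij_betw_byWitness[where f' = "\<lambda>(d, e). (d div p, e div p)"])
      show "(\<lambda>(d, e). (p * d, p * e)) ` split_pairs j \<subseteq> C"
        using mult_mod_5_iff[OF assms(2)] by (auto simp: C_def split_pairs_def j mult_ac simp del: insert_iff)
      show "(\<lambda>(d, e). (d div p, e div p)) ` C \<subseteq> split_pairs j"
      proof clarify
        fix d e assume "(d, e) \<in> C"
        then have h: "d mod 5 \<in> {1, 4}" "e mod 5 \<in> {2, 3}" "d * e = p * k" "p dvd d" "p dvd e"
          by (auto simp: C_def split_pairs_def)
        then obtain d' e' where "d = p * d'" "e = p * e'" by (auto elim!: dvdE)
        then show "(d div p, e div p) \<in> split_pairs j"
          using h p0 mult_mod_5_iff[OF assms(2)] by (auto simp: split_pairs_def j simp del: insert_iff)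
      qed
    qed (use p0 in \<open>auto simp: C_def\<close>)
    then show ?thesis using bij_betw_same_card[of _ "split_pairs j" C] p0 True by (simp add: j)
  next
    case False
    have "C = {}"
    proof (rule ccontr)
      assume "C \<noteq> {}"
      then obtain d e where "p dvd d" "p dvd e" "d * e = p * k" by (auto simp: C_def split_pairs_def)
      then have "p * p dvd p * k" by (metis mult_dvd_mono)
      then show False using False p0 by simp
    qed
    then show ?thesis using False by simp
  qed
  show ?thesis unfolding card AB C[symmetric] by simp
qed

lemma reg25_odd_card:
  assumes "0 < n"
  shows "even (num_regular_partitions 25 (2 * n - 1)) \<longleftrightarrow>
    even (of_bool (\<exists>s. \<not> 5 dvd s \<and> s\<^sup>2 = n) + card (split_pairs n))"
proof -
  have "card {s \<in> {s. \<not> 5 dvd s}. s\<^sup>2 = n} = of_bool (\<exists>s. \<not> 5 dvd s \<and> s\<^sup>2 = n)"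
  proof (cases "\<exists>s. \<not> 5 dvd s \<and> s\<^sup>2 = n")
    case True
    then obtain s where s: "\<not> 5 dvd s" "s\<^sup>2 = n" by blast
    have "t = s" if "t\<^sup>2 = n" for t using that s by (metis power2_eq_imp_eq zero_le)
    then have "{s \<in> {s. \<not> 5 dvd s}. s\<^sup>2 = n} = {s}" using s by blast
    moreover have "of_bool (\<exists>s. \<not> 5 dvd s \<and> s\<^sup>2 = n) = (1 :: nat)" using True by (simp only: of_bool_eq)
    ultimately show ?thesis by simp
  next
    case False
    then have "{s \<in> {s. \<not> 5 dvd s}. s\<^sup>2 = n} = {}" by blast
    then show ?thesis using False by (simp only: of_bool_eq card.empty)
  qed
  moreover have "{z \<in> {(d :: nat, e :: nat). d mod 5 \<in> {1, 4} \<and> e mod 5 \<in> {2, 3}}. (\<lambda>(d, e). d * e) z = n} = split_pairs n"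
    by (auto simp: split_pairs_def)
  moreover have "of_nat (num_regular_partitions 25 (2 * n - 1)) =
      (gf {s. \<not> 5 dvd s} (\<lambda>s. s\<^sup>2) + gf {(d :: nat, e :: nat). d mod 5 \<in> {1, 4} \<and> e mod 5 \<in> {2, 3}} (\<lambda>(d, e). d * e)) $ n"
    unfolding gf_squares_coprime_5 gf_pairs_eq_lambert using reg25_odd[OF assms] by (simp add: reg25_def add.assoc)
  ultimately have "(of_nat (num_regular_partitions 25 (2 * n - 1)) :: bit) =
      of_nat (of_bool (\<exists>s. \<not> 5 dvd s \<and> s\<^sup>2 = n) + card (split_pairs n))"
    by (simp add: gf_nth)
  then show ?thesis by (simp only: of_nat_bit_eq_iff)
qed

text \<open>Both terms of \<open>reg25_odd_card\<close> have this property: for the squares,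
  \<open>s^2 = p k\<close> forces \<open>p\<close> to divide \<open>s\<close>; for the pairs, see
  \<open>card_split_pairs_mult_prime\<close>.\<close>

lemma reg25_hecke:
  assumes "prime p" "p mod 5 \<in> {1, 4}" "0 < k"
  shows "even (num_regular_partitions 25 (2 * (p * k) - 1)) \<longleftrightarrow>
    even (if p dvd k then num_regular_partitions 25 (2 * (k div p) - 1) else 0)"
proof -
  have p0: "0 < p" using assms(1) by (simp add: prime_gt_0_nat)
  have sq: "(\<exists>s. \<not> 5 dvd s \<and> s\<^sup>2 = p * k) \<longleftrightarrow> p dvd k \<and> (\<exists>s. \<not> 5 dvd s \<and> s\<^sup>2 = k div p)"
  proof
    assume "\<exists>s. \<not> 5 dvd s \<and> s\<^sup>2 = p * k"
    then obtain s where s: "\<not> 5 dvd s" "s\<^sup>2 = p * k" by blast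
    then have "p dvd s" using assms(1) by (metis dvd_triv_left prime_dvd_power)
    then obtain t where t: "s = p * t" ..
    then have "k = p * t\<^sup>2" using s p0 by (simp add: power2_eq_square mult.left_commute)
    then show "p dvd k \<and> (\<exists>s. \<not> 5 dvd s \<and> s\<^sup>2 = k div p)" using s t p0 by auto
  next
    assume "p dvd k \<and> (\<exists>s. \<not> 5 dvd s \<and> s\<^sup>2 = k div p)"
    then obtain s where s: "p dvd k" "\<not> 5 dvd s" "s\<^sup>2 = k div p" by blast
    have "\<not> 5 dvd p" using assms(2) by auto
    then have "\<not> 5 dvd p * s" using s(2) prime_dvd_mult_iff[of 5 p s] by simp
    moreover have "k = p * s\<^sup>2" using s by simp
    then have "(p * s)\<^sup>2 = p * k" by (simp add: power2_eq_square)
    ultimately show "\<exists>s. \<not> 5 dvd s \<and> s\<^sup>2 = p * k" by blast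
  qed
  have pk: "0 < p * k" using p0 assms by simp
  show ?thesis
  proof (cases "p dvd k")
    case True
    then have "0 < k div p" using assms p0 by (auto elim!: dvdE)
    then show ?thesis
      using True reg25_odd_card[OF pk] reg25_odd_card[of "k div p"] card_split_pairs_mult_prime[OF assms]
      by (simp add: sq)
  next
    case False
    then show ?thesis
      using reg25_odd_card[OF pk] card_split_pairs_mult_prime[OF assms] by (simp add: sq)
  qed
qed

text \<open>The offset \<open>2 p - 1\<close> brings the index into the form
  \<open>2 (p (n + 1)) - 1\<close> of \<open>reg25_hecke\<close>, with
  \<open>k = n + 1\<close>.\<close>

theorem congruence_of_prime:
  assumes "prime p" "p mod 5 \<in> {1, 4}"
  shows "fps_cong
    (Abs_fps (\<lambda>n. int (num_regular_partitions 25 (2 * p * n + (2 * p - 1)))))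
    (fps_X ^ (p - 1) * fps_compose (Abs_fps (\<lambda>n. int (num_regular_partitions 25 (2 * n + 1)))) (fps_X ^ p)) 2"
  unfolding fps_cong_def
proof
  fix n
  have p0: "0 < p" using assms(1) by (simp add: prime_gt_0_nat)
  let ?F = "Abs_fps (\<lambda>n. int (num_regular_partitions 25 (2 * n + 1)))"
  \<comment> \<open>After the shift by \<open>p - 1\<close>, the exponent \<open>n\<close>
    contributes exactly when \<open>n + 1 = p (i + 1)\<close>; then the argument is
    \<open>2 (i + 1) - 1 = 2 i + 1\<close>.\<close>
  let ?c = "if p dvd n + 1 then num_regular_partitions 25 (2 * ((n + 1) div p) - 1) else 0"
  have "(fps_X ^ (p - 1) * (?F oo fps_X ^ p)) $ n = int ?c"
  proof (cases "p dvd n + 1")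
    case True
    then obtain j where j: "n + 1 = p * j" ..
    then obtain i where i: "j = Suc i" by (cases j) auto
    have "n = p * i + (p - 1)" using j i p0 by (simp add: algebra_simps)
    then have "\<not> n < p - 1" "n - (p - 1) = p * i" by simp_all
    then show ?thesis using p0 i j True by (simp add: fps_X_power_mult_nth fps_compose_X_power_nth)
  next
    case False
    have "\<not> p dvd n - (p - 1)" if "p - 1 \<le> n"
    proof
      assume "p dvd n - (p - 1)"
      then have "p dvd (n - (p - 1)) + p" by simp
      also have "(n - (p - 1)) + p = n + 1" using that p0 by simp
      finally show False using False by simp
    qed
    then show ?thesis using p0 False by (simp add: fps_X_power_mult_nth fps_compose_X_power_nth)
  qed
  moreover have "2 * p * n + (2 * p - 1) = 2 * (p * (n + 1)) - 1" using p0 by (simp add: algebra_simps)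
  moreover have "even (num_regular_partitions 25 (2 * (p * (n + 1)) - 1)) \<longleftrightarrow> even ?c"
    by (rule reg25_hecke[OF assms]) simp
  ultimately show "[Abs_fps (\<lambda>n. int (num_regular_partitions 25 (2 * p * n + (2 * p - 1)))) $ n =
      (fps_X ^ (p - 1) * (?F oo fps_X ^ p)) $ n] (mod 2)"
    by (simp only: fps_nth_Abs_fps) (simp add: cong_def mod_2_eq_odd)
qed

section \<open>Mertens estimates for the quadratic character modulo 5\<close>

abbreviation \<Lambda> :: "nat \<Rightarrow> real" where "\<Lambda> \<equiv> mangoldt"

text \<open>Write \<open>ln n\<close> as the sum of \<open>\<Lambda>\<close> over the divisors of
  \<open>n\<close> and exchange summations. It is applied to the constant 1 and to
  \<open>chi n / n\<close>.\<close>

lemma sum_mult_ln: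
  fixes a :: "nat \<Rightarrow> real"
  shows "(\<Sum>n\<in>{1..N}. a n * ln (real n)) = (\<Sum>d\<in>{1..N}. \<Lambda> d * (\<Sum>m\<in>{1..N div d}. a (d * m)))"
proof -
  have "(\<Sum>n\<in>{1..N}. a n * ln (real n)) = (\<Sum>n\<in>{1..N}. \<Sum>d | d dvd n. a n * \<Lambda> d)"
    using mangoldt_sum[where ?'a = real] by (intro sum.cong) (auto simp: sum_distrib_left[symmetric])
  also have "\<dots> = (\<Sum>(n, d)\<in>Sigma {1..N} (\<lambda>n. {d. d dvd n}). a n * \<Lambda> d)"
    by (rule sum.Sigma) auto
  also have "\<dots> = (\<Sum>(d, m)\<in>Sigma {1..N} (\<lambda>d. {1..N div d}). \<Lambda> d * a (d * m))"
  proof (rule sum.reindex_bij_witness[where i = "\<lambda>(d, m). (d * m, d)" and j = "\<lambda>(n, d). (d, n div d)"])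
    show "(case z of (n, d) \<Rightarrow> (d, n div d)) \<in> Sigma {1..N} (\<lambda>d. {1..N div d})"
      if "z \<in> Sigma {1..N} (\<lambda>n. {d. d dvd n})" for z
    proof -
      obtain n d where [simp]: "z = (n, d)" by fastforce
      have "0 < n" "n \<le> N" "d dvd n" using that by auto
      then have "0 < d" "d \<le> n" by (auto dest: dvd_pos_nat dvd_imp_le)
      then show ?thesis
        using \<open>n \<le> N\<close> by (simp add: Suc_le_eq div_greater_zero_iff div_le_mono)
    qed
    show "(case z of (d, m) \<Rightarrow> (d * m, d)) \<in> Sigma {1..N} (\<lambda>n. {d. d dvd n})"
      if "z \<in> Sigma {1..N} (\<lambda>d. {1..N div d})" for z
      using that by (auto simp: Suc_le_eq less_eq_div_iff_mult_less_eq mult.commute)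
  qed (auto simp: Suc_le_eq)
  also have "\<dots> = (\<Sum>d\<in>{1..N}. \<Lambda> d * (\<Sum>m\<in>{1..N div d}. a (d * m)))"
    by (simp add: sum.Sigma[symmetric] sum_distrib_left)
  finally show ?thesis .
qed

definition psi :: "nat \<Rightarrow> real" where "psi N = (\<Sum>d\<in>{1..N}. \<Lambda> d)"

lemma psi_mono: "M \<le> N \<Longrightarrow> psi M \<le> psi N"
  unfolding psi_def by (rule sum_mono2) (auto simp: mangoldt_nonneg)

lemma real_div_le: "real n / real d \<le> real (n div d) + 1"
  using real_of_int_floor_add_one_ge[of "real n / real d"] by (simp add: floor_divide_of_nat_eq)

lemma ln_fact_eq: "ln (fact N) = (\<Sum>d\<in>{1..N}. \<Lambda> d * real (N div d))"
proof -
  have "ln (fact N) = (\<Sum>n\<in>{1..N}. ln (real n))"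
    by (induction N) (simp_all add: ln_mult del: of_nat_Suc)
  then show ?thesis using sum_mult_ln[of "\<lambda>_. 1" N] by simp
qed

text \<open>Chebyshev's argument: the primes and prime powers in \<open>(n, 2 n]\<close> are
  controlled by the logarithm of the central binomial coefficient, at most
  \<open>2 n ln 2\<close>.\<close>

lemma psi_double: "psi (2 * n) - psi n \<le> 2 * real n"
proof -
  have "ln (fact (2 * n)) - 2 * ln (fact n) =
      (\<Sum>d\<in>{1..2 * n}. \<Lambda> d * (real (2 * n div d) - 2 * real (n div d)))"
  proof -
    have "(\<Sum>d\<in>{1..n}. \<Lambda> d * real (n div d)) = (\<Sum>d\<in>{1..2 * n}. \<Lambda> d * real (n div d))"
      by (rule sum.mono_neutral_left) auto
    then show ?thesis
      by (simp add: ln_fact_eq sum_subtractf sum_distrib_left algebra_simps)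
  qed
  also have "\<dots> \<ge> (\<Sum>d\<in>{n<..2 * n}. \<Lambda> d)"
  proof -
    have "(\<Sum>d\<in>{n<..2 * n}. \<Lambda> d) = (\<Sum>d\<in>{1..2 * n}. if n < d then \<Lambda> d else 0)"
      by (rule sum.mono_neutral_cong_left) auto
    also have "\<dots> \<le> (\<Sum>d\<in>{1..2 * n}. \<Lambda> d * (real (2 * n div d) - 2 * real (n div d)))"
    proof (rule sum_mono)
      fix d assume d: "d \<in> {1..2 * n}"
      have "2 * (n div d) \<le> 2 * n div d"
        using d by (simp add: less_eq_div_iff_mult_less_eq)
      then have "0 \<le> real (2 * n div d) - 2 * real (n div d)" by linarith
      moreover have "1 \<le> real (2 * n div d) - 2 * real (n div d)" if "n < d"
        using that d by (simp add: Suc_le_eq div_greater_zero_iff)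
      \<comment> \<open>For \<open>n < d \<le> 2 n\<close> the first quotient is at least 1 and the
        second is 0.\<close>
      ultimately have "of_bool (n < d) \<le> real (2 * n div d) - 2 * real (n div d)" by auto
      from mult_left_mono[OF this mangoldt_nonneg[of d]]
      show "(if n < d then \<Lambda> d else 0) \<le> \<Lambda> d * (real (2 * n div d) - 2 * real (n div d))"
        by (auto split: if_splits)
    qed
    finally show ?thesis .
  qed
  also have "(\<Sum>d\<in>{n<..2 * n}. \<Lambda> d) = psi (2 * n) - psi n"
  proof -
    have "{1..2 * n} = {1..n} \<union> {n<..2 * n}" "{1..n} \<inter> {n<..2 * n} = {}" by auto
    then show ?thesis by (simp add: psi_def sum.union_disjoint)
  qed
  finally have "psi (2 * n) - psi n \<le> ln (fact (2 * n)) - 2 * ln (fact n)" .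
  also have "\<dots> = ln (real ((2 * n) choose n))"
    by (simp add: binomial_fact ln_div ln_mult)
  also have "\<dots> \<le> ln (2 ^ (2 * n))"
    by (subst ln_le_cancel_iff) (use binomial_le_pow2[of "2 * n" n] in \<open>auto simp flip: of_nat_power simp del: power_mult\<close>)
  also have "\<dots> = 2 * real n * ln 2" by (simp add: ln_realpow)
  also have "\<dots> \<le> 2 * real n * 1" using ln_2_less_1 by (intro mult_left_mono) auto
  finally show ?thesis by simp
qed

lemma psi_le: "psi N \<le> 4 * real N"
proof (induction N rule: less_induct)
  case (less N)
  show ?case
  proof (cases "N \<le> 1")
    case True
    then have "N = 0 \<or> N = 1" by auto
    then show ?thesis by (auto simp: psi_def)
  next
    case False
    \<comment> \<open>Rounding up gives \<open>N \<le> 2 k\<close>. The resulting bound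
      \<open>3 N + 3\<close> is at most \<open>4 N\<close> from \<open>N = 3\<close> on; for
      \<open>N = 2\<close> the exact value \<open>k = 1\<close> is used.\<close>
    define k where "k = (N + 1) div 2"
    have k: "k < N" "N \<le> 2 * k" "2 * k \<le> N + 1" using False by (auto simp: k_def)
    have "psi N \<le> psi (2 * k)" using k by (intro psi_mono)
    also have "\<dots> \<le> 2 * real k + psi k" using psi_double[of k] by simp
    also have "\<dots> \<le> 6 * real k" using less.IH[OF k(1)] by simp
    also have "\<dots> \<le> 4 * real N" 
    proof -
      have "6 * k \<le> 3 * N + 3" using k by linarith
      moreover have "3 * N + 3 \<le> 4 * N \<or> N = 2" using False by linarith
      moreover have "k = 1" if "N = 2" using that by (simp add: k_def)
      ultimately have "6 * k \<le> 4 * N" by auto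
      then show ?thesis by linarith
    qed
    finally show ?thesis .
  qed
qed

lemma ln_fact_bounds:
  assumes "0 < N"
  shows "real N * ln (real N) - real N \<le> ln (fact N)" "ln (fact N) \<le> real N * ln (real N)"
proof -
  show "real N * ln (real N) - real N \<le> ln (fact N)"
    using assms
  proof (induction N rule: nat_induct_non_zero)
    case (Suc n)
    have "ln (real (Suc n)) = ln (real n) + ln (1 + 1 / real n)"
    proof -
      have "real (Suc n) = real n * (1 + 1 / real n)" using Suc by (simp add: field_simps)
      moreover have "0 < 1 + 1 / real n" by (simp add: add_pos_nonneg)
      ultimately show ?thesis using Suc by (simp only: ln_mult_pos of_nat_0_less_iff)
    qed
    also have "\<dots> \<le> ln (real n) + 1 / real n"
      using ln_add_one_self_le_self[of "1 / real n"] by simp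
    finally have "real n * ln (real (Suc n)) \<le> real n * (ln (real n) + 1 / real n)"
      by (intro mult_left_mono) auto
    also have "\<dots> = real n * ln (real n) + 1" using Suc by (simp add: field_simps)
    finally have "real n * ln (real (Suc n)) \<le> real n * ln (real n) + 1" .
    moreover have "ln (fact (Suc n)) = ln (real (Suc n)) + ln (fact n :: real)"
      by (simp only: fact_Suc) (simp add: ln_mult)
    ultimately show ?case using Suc.IH by (simp add: algebra_simps)
  qed simp
  have "ln (fact N :: real) \<le> ln (real N ^ N)"
    using fact_le_power[of N, where ?'a = real] assms by (subst ln_le_cancel_iff) auto
  then show "ln (fact N) \<le> real N * ln (real N)" using assms by (simp add: ln_realpow)
qed

text \<open>In \<open>ln_fact_eq\<close>, replacing \<open>N div d\<close> by \<open>N / d\<close>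
  costs at most \<open>psi N\<close>, hence at most \<open>4 N\<close>.\<close>

lemma mertens_first:
  assumes "0 < N"
  shows "ln (real N) - 1 \<le> (\<Sum>d\<in>{1..N}. \<Lambda> d / d)" "(\<Sum>d\<in>{1..N}. \<Lambda> d / d) \<le> ln (real N) + 4"
proof -
  have eq: "real N * (\<Sum>d\<in>{1..N}. \<Lambda> d / d) = (\<Sum>d\<in>{1..N}. \<Lambda> d * (real N / d))"
    by (simp add: sum_distrib_left algebra_simps)
  have "ln (fact N) \<le> (\<Sum>d\<in>{1..N}. \<Lambda> d * (real N / d))"
    unfolding ln_fact_eq by (intro sum_mono mult_left_mono of_nat_div_le_of_nat mangoldt_nonneg)
  then have "real N * (ln (real N) - 1) \<le> real N * (\<Sum>d\<in>{1..N}. \<Lambda> d / d)"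
    using ln_fact_bounds(1)[OF assms] unfolding eq by (simp add: algebra_simps)
  then show "ln (real N) - 1 \<le> (\<Sum>d\<in>{1..N}. \<Lambda> d / d)"
    using assms by simp
  have "(\<Sum>d\<in>{1..N}. \<Lambda> d * (real N / d)) \<le> (\<Sum>d\<in>{1..N}. \<Lambda> d * real (N div d) + \<Lambda> d)"
  proof (rule sum_mono)
    fix d assume "d \<in> {1..N}"
    have "\<Lambda> d * (real N / d) \<le> \<Lambda> d * (real (N div d) + 1)"
      using real_div_le[of N d] by (intro mult_left_mono mangoldt_nonneg) linarith
    then show "\<Lambda> d * (real N / d) \<le> \<Lambda> d * real (N div d) + \<Lambda> d" by (simp add: algebra_simps)
  qed
  also have "\<dots> = ln (fact N) + psi N" by (simp add: sum.distrib ln_fact_eq psi_def)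
  also have "\<dots> \<le> real N * ln (real N) + 4 * real N"
    using ln_fact_bounds(2)[OF assms] psi_le[of N] by simp
  finally have "real N * (\<Sum>d\<in>{1..N}. \<Lambda> d / d) \<le> real N * (ln (real N) + 4)"
    unfolding eq by (simp add: algebra_simps)
  then show "(\<Sum>d\<in>{1..N}. \<Lambda> d / d) \<le> ln (real N) + 4"
    using assms by simp
qed

section \<open>The quadratic character modulo 5 and its L-series at 1\<close>

definition chi :: "nat \<Rightarrow> real" where
  "chi n = (if n mod 5 \<in> {1, 4} then 1 else if n mod 5 \<in> {2, 3} then - 1 else 0)"

lemma chi_mult: "chi (m * n) = chi m * chi n"
proof -
  have "(m * n) mod 5 = (m mod 5) * (n mod 5) mod 5" by (simp add: mod_mult_eq)
  moreover have "m mod 5 < 5" "n mod 5 < 5" by simp_all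
  then have "m mod 5 \<in> {0, 1, 2, 3, 4}" "n mod 5 \<in> {0, 1, 2, 3, 4}" by auto
  ultimately show ?thesis unfolding chi_def by (elim insertE emptyE; simp)
qed

lemma abs_chi_le: "\<bar>chi n\<bar> \<le> 1" by (simp add: chi_def)

lemma sum_chi: "(\<Sum>i<n. chi i) = (if n mod 5 \<in> {2, 4} then (if n mod 5 = 2 then 1 else - 1) else 0)"
proof (induction n)
  case (Suc n)
  have "n mod 5 < 5" by simp
  then have "n mod 5 \<in> {0, 1, 2, 3, 4}" by auto
  then show ?case using Suc by (elim insertE emptyE; simp add: chi_def mod_Suc)
qed simp

lemma abs_sum_chi_le: "\<bar>\<Sum>i<n. chi i\<bar> \<le> 1"
  unfolding sum_chi by auto

text \<open>Summation by parts against the partial sums of \<open>chi\<close>, which are bounded by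
  1.\<close>

lemma abel_chi:
  fixes f :: "nat \<Rightarrow> real"
  assumes "a \<le> b" "\<And>n. a \<le> n \<Longrightarrow> 0 \<le> f n" "\<And>n. a \<le> n \<Longrightarrow> f (Suc n) \<le> f n"
  shows "\<bar>\<Sum>n\<in>{a..b}. chi n * f n\<bar> \<le> 2 * f a"
proof -
  let ?s = "\<lambda>n. \<Sum>i<n. chi i"
  \<comment> \<open>Removing the boundary term and lowering the bound by \<open>f b\<close> lets the
    induction telescope.\<close>
  have "\<bar>(\<Sum>n\<in>{a..b}. chi n * f n) - ?s (Suc b) * f b\<bar> \<le> 2 * f a - f b"
    using assms(1)
  proof (induction b rule: dec_induct)
    case base
    have "\<bar>?s a * f a\<bar> \<le> 1 * f a"
      unfolding abs_mult using assms(2)[of a] abs_sum_chi_le[of a] by (intro mult_mono) auto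
    then show ?case by (simp add: algebra_simps)
  next
    case (step b)
    have "{a..Suc b} = insert (Suc b) {a..b}" using step by auto
    then have eq: "(\<Sum>n\<in>{a..Suc b}. chi n * f n) - ?s (Suc (Suc b)) * f (Suc b) =
        ((\<Sum>n\<in>{a..b}. chi n * f n) - ?s (Suc b) * f b) + ?s (Suc b) * (f b - f (Suc b))"
      by (simp add: algebra_simps)
    have "\<bar>?s (Suc b) * (f b - f (Suc b))\<bar> \<le> 1 * (f b - f (Suc b))"
      unfolding abs_mult using assms(3)[of b] step abs_sum_chi_le[of "Suc b"] by (intro mult_mono) auto
    from order_trans[OF abs_triangle_ineq add_mono[OF step.IH this]]
    show ?case unfolding eq by simp
  qed
  moreover have "\<bar>?s (Suc b) * f b\<bar> \<le> 1 * f b"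
    unfolding abs_mult using assms(1) assms(2)[of b] abs_sum_chi_le[of "Suc b"] by (intro mult_mono) auto
  ultimately show ?thesis by linarith
qed

definition partial_L :: "nat \<Rightarrow> real" where
  "partial_L n = (\<Sum>m\<in>{1..n}. chi m / m)"

lemma partial_L_diff:
  assumes "k \<le> N"
  shows "\<bar>partial_L N - partial_L k\<bar> \<le> 2 / (real k + 1)"
proof (cases "k < N")
  case True
  have "{1..N} = {1..k} \<union> {Suc k..N}" using assms by auto
  then have "partial_L N - partial_L k = (\<Sum>m\<in>{Suc k..N}. chi m * (1 / m))"
    by (simp add: partial_L_def sum.union_disjoint)
  also have "\<bar>\<dots>\<bar> \<le> 2 * (1 / real (Suc k))"
    by (rule abel_chi) (use True in \<open>auto simp: field_simps\<close>)
  finally show ?thesis by (simp add: add.commute)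
qed (use assms in auto)

text \<open>An effective nonvanishing of \<open>L(1, chi)\<close>: the value at 4 is
  \<open>5/12\<close>, and later terms change it by at most \<open>2/5\<close>.\<close>

lemma partial_L_ge:
  assumes "4 \<le> N"
  shows "1 / 60 \<le> partial_L N"
proof -
  have "partial_L 4 = 5 / 12"
  proof -
    have "{1..4 :: nat} = {1, 2, 3, 4}" by auto
    then show ?thesis by (simp add: partial_L_def chi_def)
  qed
  moreover have "2 / (real 4 + 1) = (2 / 5 :: real)" by simp
  ultimately show ?thesis using partial_L_diff[OF assms] by linarith
qed

lemma sum_chi_ln:
  "\<bar>\<Sum>n\<in>{1..N}. chi n / n * ln (real n)\<bar> \<le> 3"
proof -
  have ln2: "ln 2 \<le> (1 :: real)" using ln_2_less_1 by simp
  have ln3: "ln (real 3) / real 3 \<le> 1" using ln_le_minus_one[of "3 :: real"] by simp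
  show ?thesis
  proof (cases "3 \<le> N")
    case True
    \<comment> \<open>\<open>ln x / x\<close> decreases only beyond \<open>exp 1\<close>, so Abel
      summation starts at 3.\<close>
    have "{1..N} = {1..2} \<union> {3..N}" using True by auto
    then have "(\<Sum>n\<in>{1..N}. chi n / n * ln (real n)) =
        (\<Sum>n\<in>{1..2}. chi n / n * ln (real n)) + (\<Sum>n\<in>{3..N}. chi n * (ln (real n) / n))"
      by (simp add: sum.union_disjoint)
    moreover have "(\<Sum>n\<in>{1..2}. chi n / n * ln (real n)) = - ln 2 / 2"
    proof -
      have "{1..2 :: nat} = {1, 2}" by auto
      then show ?thesis by (simp add: chi_def)
    qed
    moreover have "\<bar>\<Sum>n\<in>{3..N}. chi n * (ln (real n) / n)\<bar> \<le> 2 * (ln (real 3) / real 3)"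
      using True exp_le by (intro abel_chi ln_x_over_x_mono) auto
    moreover have "0 \<le> ln (2 :: real)" by simp
    ultimately show ?thesis using ln2 ln3 by linarith
  next
    case False
    then have "N = 0 \<or> N = 1 \<or> N = 2" by auto
    moreover have "{1..2 :: nat} = {1, 2}" by auto
    moreover have "0 \<le> ln (2 :: real)" by simp
    ultimately show ?thesis using ln2 by (elim disjE) (simp_all add: chi_def)
  qed
qed

text \<open>As \<open>chi\<close> is multiplicative, \<open>sum_mult_ln\<close> gives a sum with
  weights \<open>partial_L (N div d)\<close>. Replacing these by \<open>partial_L N\<close> costs at
  most \<open>2 psi N / N \<le> 8\<close>; dividing by \<open>1/60\<close> yields
  \<open>660 = 60 * (3 + 8)\<close>.\<close>

lemma mertens_chi:
  assumes "4 \<le> N"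
  shows "\<bar>\<Sum>d\<in>{1..N}. chi d * \<Lambda> d / d\<bar> \<le> 660"
proof -
  let ?X = "\<Sum>d\<in>{1..N}. chi d * \<Lambda> d / d"
  have "(\<Sum>n\<in>{1..N}. chi n / n * ln (real n)) = (\<Sum>d\<in>{1..N}. chi d * \<Lambda> d / d * partial_L (N div d))"
    unfolding sum_mult_ln partial_L_def
    by (intro sum.cong) (auto simp: chi_mult sum_distrib_left field_simps)
  then have "partial_L N * ?X = (\<Sum>n\<in>{1..N}. chi n / n * ln (real n)) +
      (\<Sum>d\<in>{1..N}. chi d * \<Lambda> d / d * (partial_L N - partial_L (N div d)))"
    by (simp only: sum_distrib_left sum.distrib[symmetric]) (intro sum.cong refl, simp add: field_simps)
  moreover have "\<bar>\<Sum>d\<in>{1..N}. chi d * \<Lambda> d / d * (partial_L N - partial_L (N div d))\<bar> \<le> 8"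
  proof -
    have "\<bar>\<Sum>d\<in>{1..N}. chi d * \<Lambda> d / d * (partial_L N - partial_L (N div d))\<bar> \<le>
        (\<Sum>d\<in>{1..N}. \<Lambda> d * (2 / N))"
    proof (rule order_trans[OF sum_abs], rule sum_mono)
      fix d assume d: "d \<in> {1..N}"
      have "\<bar>partial_L N - partial_L (N div d)\<bar> \<le> 2 / (real (N div d) + 1)"
        by (rule partial_L_diff) simp
      also have "\<dots> \<le> 2 / (real N / d)"
        using d real_div_le[of N d] by (intro divide_left_mono) (auto simp: add_pos_nonneg)
      finally have "\<bar>partial_L N - partial_L (N div d)\<bar> \<le> 2 * d / N" by simp
      moreover have "\<bar>chi d * \<Lambda> d / d\<bar> \<le> \<Lambda> d / d"
        using abs_chi_le[of d] mangoldt_nonneg[of d] by (auto simp: abs_mult intro!: divide_right_mono mult_left_le_one_le)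
      ultimately have "\<bar>chi d * \<Lambda> d / d\<bar> * \<bar>partial_L N - partial_L (N div d)\<bar> \<le> \<Lambda> d / d * (2 * d / N)"
        using mangoldt_nonneg[of d] by (intro mult_mono) auto
      then show "\<bar>chi d * \<Lambda> d / d * (partial_L N - partial_L (N div d))\<bar> \<le> \<Lambda> d * (2 / N)"
        using d by (simp add: abs_mult)
    qed
    also have "\<dots> = psi N * 2 / N" by (simp add: psi_def sum_distrib_right sum_divide_distrib)
    also have "\<dots> \<le> 8" using psi_le[of N] assms by (simp add: field_simps)
    finally show ?thesis .
  qed
  ultimately have "\<bar>partial_L N * ?X\<bar> \<le> 11" using sum_chi_ln[of N] by linarith
  moreover have "1 / 60 * \<bar>?X\<bar> \<le> partial_L N * \<bar>?X\<bar>"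
    using partial_L_ge[OF assms] by (intro mult_right_mono) auto
  moreover have "0 \<le> partial_L N" using partial_L_ge[OF assms] by simp
  ultimately show ?thesis by (simp add: abs_mult)
qed

section \<open>Density of the primes congruent to 1 and -1 modulo 5\<close>

text \<open>Only powers of 5 carry weight, and their geometric series is at most
  \<open>ln 5 / 4\<close>.\<close>

lemma sum_mangoldt_multiples_5: "(\<Sum>d | d \<in> {1..N} \<and> 5 dvd d. \<Lambda> d / d) \<le> 1"
proof -
  have "(\<Sum>d | d \<in> {1..N} \<and> 5 dvd d. \<Lambda> d / d) \<le> (\<Sum>d\<in>(\<lambda>k. 5 ^ Suc k) ` {..<N}. \<Lambda> d / d)"
  proof -
    have "\<Lambda> d / d = 0" if d: "d \<in> {1..N}" "5 dvd d" "d \<notin> (\<lambda>k. 5 ^ Suc k) ` {..<N}" for d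
    proof (cases "primepow d")
      case True
      then obtain p k where pk: "prime p" "0 < k" "d = p ^ k" by (auto simp: primepow_def)
      then have "5 dvd p" using d(2) prime_dvd_power[of 5 p k] by simp
      then have "p = 5" using pk(1) primes_dvd_imp_eq[of 5 p] by simp
      moreover obtain j where "k = Suc j" using pk(2) by (cases k) auto
      moreover have "j < N"
      proof -
        have "j < 5 ^ j" by (rule less_exp[THEN less_le_trans]) (simp add: power_mono)
        also have "(5 :: nat) ^ j \<le> 5 ^ Suc j" by simp
        also have "\<dots> \<le> N" using d(1) pk \<open>p = 5\<close> \<open>k = Suc j\<close> by simp
        finally show ?thesis .
      qed
      ultimately show ?thesis using d(3) pk by blast
    qed (simp add: mangoldt_def)
    then have "(\<Sum>d | d \<in> {1..N} \<and> 5 dvd d. \<Lambda> d / d) =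
        (\<Sum>d\<in>{d. d \<in> {1..N} \<and> 5 dvd d} \<inter> (\<lambda>k. 5 ^ Suc k) ` {..<N}. \<Lambda> d / d)"
      by (intro sum.mono_neutral_right) auto
    also have "\<dots> \<le> (\<Sum>d\<in>(\<lambda>k. 5 ^ Suc k) ` {..<N}. \<Lambda> d / d)"
      by (intro sum_mono2) (auto simp: mangoldt_nonneg)
    finally show ?thesis .
  qed
  also have "\<dots> = (\<Sum>k<N. \<Lambda> (5 ^ Suc k) / real (5 ^ Suc k))"
    by (subst sum.reindex) (auto simp: inj_on_def)
  also have "\<dots> = (\<Sum>k<N. ln 5 / 5 * (1 / 5) ^ k)"
  proof (rule sum.cong)
    fix k
    have "\<Lambda> (5 ^ Suc k) = ln 5" using mangoldt_primepow[of 5 "Suc k", where ?'a = real] by simp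
    then show "\<Lambda> (5 ^ Suc k) / real (5 ^ Suc k) = ln 5 / 5 * (1 / 5) ^ k"
      by (simp add: power_divide)
  qed simp
  also have "\<dots> = ln 5 / 5 * ((1 - (1 / 5) ^ N) / (1 - 1 / 5))"
    by (simp only: sum_distrib_left[symmetric]) (subst sum_gp_strict, simp)
  also have "\<dots> \<le> ln 5 / 5 * (1 / (1 - 1 / 5))"
    by (intro mult_left_mono divide_right_mono) auto
  also have "\<dots> \<le> 1" using ln_le_minus_one[of "5 :: real"] by simp
  finally show ?thesis .
qed

text \<open>Twice the indicator of \<open>chi d = 1\<close> is \<open>1 + chi d\<close> minus the
  indicator of \<open>5 dvd d\<close>. Halving the total error, at most \<open>660 + 4\<close>, fits
  within 333.\<close>

lemma mertens_residues:
  assumes "4 \<le> N"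
  shows "\<bar>(\<Sum>d | d \<in> {1..N} \<and> chi d = 1. \<Lambda> d / d) - ln (real N) / 2\<bar> \<le> 333"
proof -
  let ?M = "\<Sum>d\<in>{1..N}. \<Lambda> d / d" and ?X = "\<Sum>d\<in>{1..N}. chi d * \<Lambda> d / d"
    and ?F = "\<Sum>d | d \<in> {1..N} \<and> 5 dvd d. \<Lambda> d / d"
  have "2 * (\<Sum>d | d \<in> {1..N} \<and> chi d = 1. \<Lambda> d / d) = (\<Sum>d\<in>{1..N}. if chi d = 1 then 2 * (\<Lambda> d / d) else 0)"
    unfolding sum_distrib_left by (rule sum.mono_neutral_cong_left) auto
  also have "\<dots> = (\<Sum>d\<in>{1..N}. \<Lambda> d / d + chi d * \<Lambda> d / d - (if 5 dvd d then \<Lambda> d / d else 0))"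
  proof (rule sum.cong)
    fix d :: nat
    have "d mod 5 < 5" by simp
    then have "d mod 5 \<in> {0, 1, 2, 3, 4}" by auto
    then show "(if chi d = 1 then 2 * (\<Lambda> d / d) else 0) = \<Lambda> d / d + chi d * \<Lambda> d / d - (if 5 dvd d then \<Lambda> d / d else 0)"
      by (elim insertE emptyE) (simp_all add: chi_def dvd_eq_mod_eq_0)
  qed simp
  also have "\<dots> = ?M + ?X - (\<Sum>d\<in>{1..N}. if 5 dvd d then \<Lambda> d / d else 0)"
    by (simp add: sum_subtractf sum.distrib)
  also have "(\<Sum>d\<in>{1..N}. if 5 dvd d then \<Lambda> d / d else 0) = ?F"
    by (rule sum.mono_neutral_cong_right) auto
  finally have "2 * (\<Sum>d | d \<in> {1..N} \<and> chi d = 1. \<Lambda> d / d) = ?M + ?X - ?F" .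
  moreover have "0 \<le> ?F" by (intro sum_nonneg) (auto simp: mangoldt_nonneg)
  moreover have "0 < N" using assms by simp
  ultimately show ?thesis
    using mertens_first[of N] mertens_chi[OF assms] sum_mangoldt_multiples_5[of N] by linarith
qed

text \<open>Comparing \<open>mertens_residues\<close> at \<open>N\<close> and \<open>c N\<close>
  gives the block \<open>(N, c N]\<close> total weight at least 1 in the sum of
  \<open>\<Lambda> d / d\<close>, and there \<open>1 / d \<le> 1 / N\<close>.\<close>

lemma psi_residues_lower_bound:
  obtains c :: nat where "1 \<le> c" "\<And>N. 4 \<le> N \<Longrightarrow> real N \<le> (\<Sum>d | d \<in> {1..c * N} \<and> chi d = 1. \<Lambda> d)"
proof -
  \<comment> \<open>Then \<open>ln c / 2 \<ge> 670\<close>, which exceeds the two errors of 333 by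
    more than 1.\<close>
  obtain c :: nat where c: "exp 1340 \<le> real c" using real_arch_simple by blast
  have c1: "1 \<le> c"
  proof (rule ccontr)
    assume "\<not> 1 \<le> c"
    then have "c = 0" by simp
    then show False using c exp_gt_zero[of "1340 :: real"] by linarith
  qed
  have lnc: "1340 \<le> ln (real c)" using c c1 by (subst ln_ge_iff) auto
  have "real N \<le> (\<Sum>d | d \<in> {1..c * N} \<and> chi d = 1. \<Lambda> d)" if N: "4 \<le> N" for N
  proof -
    have le: "N \<le> c * N" using c1 by simp
    let ?A = "{d. d \<in> {1..N} \<and> chi d = 1}" and ?B = "{d. d \<in> {N<..c * N} \<and> chi d = 1}"
      and ?C = "{d. d \<in> {1..c * N} \<and> chi d = 1}"
    have "?C = ?A \<union> ?B" "?A \<inter> ?B = {}" using le by (auto intro: order_trans)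
    then have split: "(\<Sum>d\<in>?C. \<Lambda> d / d) = (\<Sum>d\<in>?A. \<Lambda> d / d) + (\<Sum>d\<in>?B. \<Lambda> d / d)"
      by (simp add: sum.union_disjoint)
    have "ln (real (c * N)) = ln (real c) + ln (real N)" using c1 N by (simp add: ln_mult)
    moreover have "4 \<le> c * N" using N le by linarith
    ultimately have "1 \<le> (\<Sum>d\<in>?B. \<Lambda> d / d)"
      using mertens_residues[OF N] mertens_residues[of "c * N"] lnc split by linarith
    also have "\<dots> \<le> (\<Sum>d\<in>?B. \<Lambda> d / N)"
      using N by (intro sum_mono divide_left_mono) (auto simp: mangoldt_nonneg)
    finally have "real N \<le> (\<Sum>d\<in>?B. \<Lambda> d)" using N by (simp add: sum_divide_distrib[symmetric] field_simps)
    also have "\<dots> \<le> (\<Sum>d\<in>?C. \<Lambda> d)"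
      by (intro sum_mono2) (auto simp: mangoldt_nonneg)
    finally show ?thesis .
  qed
  with c1 that show ?thesis by blast
qed

section \<open>From sums of the von Mangoldt function to counts of primes\<close>

lemma card_nonprime_primepow: "real (card {d \<in> {1..x}. primepow d \<and> \<not> prime d}) \<le> 2 * sqrt (real x)"
proof -
  define E where "E = {1..nat \<lfloor>sqrt (real x)\<rfloor>}"
  have "{d \<in> {1..x}. primepow d \<and> \<not> prime d} \<subseteq> (\<lambda>(e, b). e\<^sup>2 * aprimedivisor e ^ b) ` (E \<times> {0, 1})"
  proof
    fix d assume "d \<in> {d \<in> {1..x}. primepow d \<and> \<not> prime d}"
    then have d: "1 \<le> d" "d \<le> x" "primepow d" "\<not> prime d" by auto
    then obtain p k where pk: "prime p" "0 < k" "d = p ^ k" by (auto simp: primepow_def)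
    have "k \<noteq> 1" using pk d by auto
    then have k: "0 < k div 2" using pk by auto
    let ?e = "p ^ (k div 2)"
    \<comment> \<open>A proper prime power \<open>p^k\<close> is determined by
      \<open>p^(k div 2)\<close>, which is at most \<open>sqrt x\<close>, and the parity of
      \<open>k\<close>: \<open>aprimedivisor\<close> recovers \<open>p\<close>.\<close>
    have "d = ?e\<^sup>2 * aprimedivisor ?e ^ (k mod 2)"
      using pk k by (simp add: aprimedivisor_prime_power power_mult[symmetric] power_add[symmetric])
    moreover have "?e \<in> E"
    proof -
      have "1 \<le> p" using pk prime_ge_1_nat by blast
      then have "?e\<^sup>2 \<le> d" unfolding pk power_mult[symmetric] by (intro power_increasing) auto
      then have "real (?e\<^sup>2) \<le> real x" using d by linarith
      then have "real ?e \<le> sqrt (real x)" by (simp add: real_le_rsqrt)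
      then show ?thesis using \<open>1 \<le> p\<close> by (auto simp: E_def le_nat_floor Suc_le_eq)
    qed
    moreover have "k mod 2 \<in> {0, 1}" by auto
    ultimately show "d \<in> (\<lambda>(e, b). e\<^sup>2 * aprimedivisor e ^ b) ` (E \<times> {0, 1})" by force
  qed
  then have "card {d \<in> {1..x}. primepow d \<and> \<not> prime d} \<le> card (E \<times> {0 :: nat, 1})"
    by (rule surj_card_le[rotated]) (simp add: E_def)
  also have "\<dots> = 2 * nat \<lfloor>sqrt (real x)\<rfloor>" by (simp add: E_def card_cartesian_product)
  finally have "real (card {d \<in> {1..x}. primepow d \<and> \<not> prime d}) \<le> 2 * real (nat \<lfloor>sqrt (real x)\<rfloor>)" by linarith
  also have "real (nat \<lfloor>sqrt (real x)\<rfloor>) \<le> sqrt (real x)" by (rule of_nat_floor) simp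
  finally show ?thesis by simp
qed

lemma psi_residues_le:
  fixes x :: nat
  assumes "1 \<le> x"
  shows "(\<Sum>d | d \<in> {1..x} \<and> chi d = 1. \<Lambda> d) \<le>
    real (card {p. prime p \<and> chi p = 1 \<and> p \<le> x}) * ln x + 2 * sqrt x * ln x"
proof -
  let ?P = "{p. prime p \<and> chi p = 1 \<and> p \<le> x}" and ?Q = "{d \<in> {1..x}. primepow d \<and> \<not> prime d}"
  have fin: "finite ?P" by (rule finite_subset[of _ "{..x}"]) auto
  have "(\<Sum>d | d \<in> {1..x} \<and> chi d = 1. \<Lambda> d) \<le> (\<Sum>d\<in>?P \<union> ?Q. \<Lambda> d)"
  proof -
    have "(\<Sum>d | d \<in> {1..x} \<and> chi d = 1. \<Lambda> d) = (\<Sum>d | d \<in> {1..x} \<and> chi d = 1 \<and> primepow d. \<Lambda> d)"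
      by (rule sum.mono_neutral_right) (auto simp: mangoldt_def)
    also have "\<dots> \<le> (\<Sum>d\<in>?P \<union> ?Q. \<Lambda> d)"
      by (rule sum_mono2) (use fin in \<open>auto simp: mangoldt_nonneg\<close>)
    finally show ?thesis .
  qed
  also have "\<dots> \<le> (\<Sum>d\<in>?P \<union> ?Q. ln x)"
  proof (rule sum_mono)
    fix d assume "d \<in> ?P \<union> ?Q"
    then have "0 < d" "d \<le> x" by (auto simp: prime_gt_0_nat)
    then have "\<Lambda> d \<le> ln d" using mangoldt_le[of d] by simp
    also have "\<dots> \<le> ln x" using \<open>0 < d\<close> \<open>d \<le> x\<close> by simp
    finally show "\<Lambda> d \<le> ln x" .
  qed
  also have "\<dots> = real (card (?P \<union> ?Q)) * ln x" by simp
  also have "\<dots> \<le> (real (card ?P) + 2 * sqrt x) * ln x"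
  proof (rule mult_right_mono)
    have "card (?P \<union> ?Q) \<le> card ?P + card ?Q" by (rule card_Un_le)
    then show "real (card (?P \<union> ?Q)) \<le> real (card ?P) + 2 * sqrt x"
      using card_nonprime_primepow[of x] by linarith
  qed (use assms in simp)
  finally show ?thesis by (simp add: algebra_simps)
qed

text \<open>A prime beyond \<open>sqrt x\<close> contributes at least \<open>ln x / 2\<close> to
  \<open>psi x\<close>; at most \<open>sqrt x\<close> primes lie below.\<close>

lemma card_primes_le:
  fixes x :: nat
  assumes "2 \<le> x"
  shows "real (card {p. prime p \<and> p \<le> x}) * ln x \<le> 8 * real x + sqrt x * ln x"
proof -
  let ?P = "{p. prime p \<and> p \<le> x}" and ?A = "{1..nat \<lfloor>sqrt (real x)\<rfloor>}"
  have fin: "finite ?P" by (rule finite_subset[of _ "{..x}"]) auto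
  have "real (card (?P - ?A)) * (ln x / 2) = (\<Sum>p\<in>?P - ?A. ln x / 2)" by simp
  also have "\<dots> \<le> (\<Sum>p\<in>?P - ?A. \<Lambda> p)"
  proof (rule sum_mono)
    fix p assume p: "p \<in> ?P - ?A"
    then have "nat \<lfloor>sqrt (real x)\<rfloor> < p" by (auto simp: Suc_le_eq prime_gt_0_nat)
    then have "sqrt (real x) \<le> real p" by linarith
    moreover have "0 < sqrt (real x)" using assms by simp
    ultimately have "ln (sqrt x) \<le> ln p" by (subst ln_le_cancel_iff) linarith+
    then show "ln x / 2 \<le> \<Lambda> p" using p assms by (simp add: ln_sqrt)
  qed
  also have "\<dots> \<le> psi x"
    unfolding psi_def by (rule sum_mono2) (auto simp: mangoldt_nonneg Suc_le_eq prime_gt_0_nat)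
  also have "\<dots> \<le> 4 * real x" by (rule psi_le)
  finally have 1: "real (card (?P - ?A)) * ln x \<le> 8 * real x" by simp
  have "card ?P \<le> card ((?P - ?A) \<union> ?A)" using fin by (intro card_mono) auto
  also have "\<dots> \<le> card (?P - ?A) + card ?A" by (rule card_Un_le)
  finally have "real (card ?P) \<le> real (card (?P - ?A)) + real (nat \<lfloor>sqrt (real x)\<rfloor>)"
    by (simp only: card_atLeastAtMost of_nat_add[symmetric] of_nat_le_iff)
  also have "real (nat \<lfloor>sqrt (real x)\<rfloor>) \<le> sqrt x" by (rule of_nat_floor) simp
  finally have "real (card ?P) * ln x \<le> (real (card (?P - ?A)) + sqrt x) * ln x"
    using assms by (intro mult_right_mono) auto
  then show ?thesis using 1 by (simp add: algebra_simps)
qed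

lemma prime_residues_positive_lower_density:
  "0 < lower_prime_density {p. prime p \<and> p mod 5 \<in> {1, 4}}"
proof -
  obtain c :: nat where c: "1 \<le> c" "\<And>N. 4 \<le> N \<Longrightarrow> real N \<le> (\<Sum>d | d \<in> {1..c * N} \<and> chi d = 1. \<Lambda> d)"
    using psi_residues_lower_bound by blast
  \<comment> \<open>Here \<open>1 / c = 8 \<epsilon>\<close>. For \<open>x \<ge> 8 c\<close>
    rounding leaves \<open>x div c \<ge> 7 \<epsilon> x\<close>, and proper prime powers take at
    most \<open>2 \<epsilon> x\<close> once \<open>ln x < \<epsilon> sqrt x\<close>. The remaining
    \<open>5 \<epsilon> x\<close> is compared with \<open>9 x\<close> for all primes.\<close>
  define \<epsilon> where "\<epsilon> = 1 / (8 * real c)"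
  have eps: "0 < \<epsilon>" "\<epsilon> \<le> 1" using c by (auto simp: \<epsilon>_def field_simps)
  have lim: "((\<lambda>x :: nat. ln x / sqrt x) \<longlongrightarrow> 0) sequentially"
  proof -
    have "((\<lambda>x :: nat. ln (sqrt x) / sqrt x) \<longlongrightarrow> 0) sequentially"
      by (rule filterlim_compose[OF ln_x_over_x_tendsto_0])
        (rule filterlim_compose[OF sqrt_at_top filterlim_real_sequentially])
    from tendsto_mult[OF tendsto_const[of 2] this] have "((\<lambda>x :: nat. 2 * (ln (sqrt x) / sqrt x)) \<longlongrightarrow> 0) sequentially" by simp
    then show ?thesis
      by (rule Lim_transform_eventually) (use eventually_gt_at_top[of 0] in eventually_elim, simp add: ln_sqrt)
  qed
  have "eventually (\<lambda>x. \<epsilon> / 9 \<le> real (card {p \<in> {p. prime p \<and> p mod 5 \<in> {1, 4}}. prime p \<and> p \<le> x}) /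
      real (card {p. prime p \<and> p \<le> x})) sequentially"
    using order_tendstoD(2)[OF lim eps(1)] eventually_ge_at_top[of "8 * c"]
  proof eventually_elim
    case (elim x)
    let ?P = "{p. prime p \<and> chi p = 1 \<and> p \<le> x}" and ?A = "{p. prime p \<and> p \<le> x}"
    have x: "8 \<le> x" using elim c by (metis le_trans mult.right_neutral mult_le_mono2)
    have "ln x < \<epsilon> * sqrt x" using elim(1) x by (simp add: pos_divide_less_eq)
    then have "sqrt x * ln x \<le> sqrt x * (\<epsilon> * sqrt x)" by (intro mult_left_mono) auto
    then have s: "sqrt x * ln x \<le> \<epsilon> * x" by (simp add: mult.left_commute)
    define N where "N = x div c"
    have N: "4 \<le> N" "c * N \<le> x" using elim(2) c by (auto simp: N_def less_eq_div_iff_mult_less_eq)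
    have "real x / c \<le> real N + 1" unfolding N_def using real_div_le .
    moreover have "1 \<le> real x / (8 * c)" using elim(2) c by (simp add: field_simps)
    ultimately have "real x / c - real x / (8 * c) \<le> real N" by linarith
    moreover have "real x / c - real x / (8 * c) = 7 * \<epsilon> * x" by (simp add: \<epsilon>_def field_simps)
    ultimately have "7 * \<epsilon> * x \<le> real N" by simp
    also have "\<dots> \<le> (\<Sum>d | d \<in> {1..c * N} \<and> chi d = 1. \<Lambda> d)" by (rule c(2)[OF N(1)])
    also have "\<dots> \<le> (\<Sum>d | d \<in> {1..x} \<and> chi d = 1. \<Lambda> d)"
      using N by (intro sum_mono2) (auto simp: mangoldt_nonneg)
    also have "\<dots> \<le> real (card ?P) * ln x + 2 * sqrt x * ln x"
      using x by (intro psi_residues_le) simp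
    finally have P: "5 * \<epsilon> * x \<le> real (card ?P) * ln x" using s by simp
    have "real (card ?A) * ln x \<le> 8 * real x + sqrt x * ln x" using x by (intro card_primes_le) simp
    also have "\<dots> \<le> 8 * real x + 1 * real x" using s mult_right_mono[OF eps(2), of "real x"] by simp
    finally have "real (card ?A) * ln x \<le> 9 * real x" by simp
    then have "\<epsilon> / 9 * (real (card ?A) * ln x) \<le> \<epsilon> / 9 * (9 * real x)"
      using eps by (intro mult_left_mono) auto
    also have "\<dots> \<le> 5 * \<epsilon> * x" using eps by (simp add: mult_right_mono)
    also note P
    finally have "\<epsilon> / 9 * real (card ?A) * ln x \<le> real (card ?P) * ln x" by (simp only: mult.assoc)
    then have le: "\<epsilon> / 9 * real (card ?A) \<le> real (card ?P)" using x by simp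
    have "2 \<in> ?A" using x by simp
    moreover have "finite ?A" by (rule finite_subset[of _ "{..x}"]) auto
    ultimately have "0 < card ?A" by (metis card_gt_0_iff empty_iff)
    moreover have "{p \<in> {p. prime p \<and> p mod 5 \<in> {1, 4}}. prime p \<and> p \<le> x} = ?P"
      by (auto simp: chi_def)
    ultimately show ?case using le by (simp add: pos_le_divide_eq)
  qed
  then have "ereal (\<epsilon> / 9) \<le> lower_prime_density {p. prime p \<and> p mod 5 \<in> {1, 4}}"
    unfolding lower_prime_density_def by (intro Liminf_bounded) (simp only: ereal_less_eq)
  moreover have "0 < ereal (\<epsilon> / 9)" using eps by simp
  ultimately show ?thesis by (rule less_le_trans[rotated])
qed

lemma lower_prime_density_mono:
  assumes "S \<subseteq> T"
  shows "lower_prime_density S \<le> lower_prime_density T"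
  unfolding lower_prime_density_def
proof (intro Liminf_mono always_eventually allI)
  fix x :: nat
  have "card {p \<in> S. prime p \<and> p \<le> x} \<le> card {p \<in> T. prime p \<and> p \<le> x}"
    using assms by (intro card_mono finite_subset[of "{p \<in> T. prime p \<and> p \<le> x}" "{..x}"]) auto
  then show "ereal (real (card {p \<in> S. prime p \<and> p \<le> x}) / real (card {p. prime p \<and> p \<le> x})) \<le>
      ereal (real (card {p \<in> T. prime p \<and> p \<le> x}) / real (card {p. prime p \<and> p \<le> x}))"
    by (simp add: divide_right_mono)
qed

theorem theorem1p2:
  shows "lower_prime_density
    {p. prime p \<and>
        (\<exists>\<alpha> \<beta> :: nat.
           fps_cong
             (Abs_fps (\<lambda>n. int (num_regular_partitions 25 (2 * p * n + \<alpha>))))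
             (fps_X ^ \<beta> * fps_compose (Abs_fps (\<lambda>n. int (num_regular_partitions 25 (2 * n + 1)))) (fps_X ^ p))
             2)} > 0"
proof -
  let ?S = "{p. prime p \<and>
        (\<exists>\<alpha> \<beta> :: nat.
           fps_cong
             (Abs_fps (\<lambda>n. int (num_regular_partitions 25 (2 * p * n + \<alpha>))))
             (fps_X ^ \<beta> * fps_compose (Abs_fps (\<lambda>n. int (num_regular_partitions 25 (2 * n + 1)))) (fps_X ^ p))
             2)}"
  have "{p. prime p \<and> p mod 5 \<in> {1, 4}} \<subseteq> ?S"
    using congruence_of_prime by blast
  from less_le_trans[OF prime_residues_positive_lower_density lower_prime_density_mono[OF this]]
  show ?thesis .
qed

end
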